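(* If $d\ge3$, $\sum_{z\in\mathbb{Z}^d}|z|^2a(z)<\infty$, $\sum_{x\in\mathbb{Z}^d}|B(x)|^{d/2}<\infty$ and $B\ge0$, then there exists $\varkappa_{cr}$ such that $N_0(B)=0$ if $\varkappa>\varkappa_{cr}$, and $N_0(B)\ge1$ if $\varkappa<\varkappa_{cr}$.
   Context: $\varkappa>0$. The kernel $a:\mathbb{Z}^d\to[0,\infty)$ satisfies $a(z)=a(-z)$, $a(0)=0$, $a(z)>0$ if $|z|=1$, $\sum_za(z)=1$; $\mathcal{A}f(x)=\sum_{z\ne0}a(z)(f(x+z)-f(x))$. $\mathcal{H}_2=2\varkappa\mathcal{A}+B(x)$ on $l^2(\mathbb{Z}^d)$, where $B$ acts by multiplication and is the correlation function $B(x)=\sum_zb(x-z)b(-z)$ with $b:\mathbb{Z}^d\to\mathbb{R}$, $\sum_z|b(z)|<\infty$, $B(0)>0$. $N_0(B)$ is the number of positive eigenvalues (counted with multiplicity) of $\mathcal{H}_2$. *)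

theory Defs
  imports "HOL-Analysis.Analysis" "HOL-Library.Function_Algebras"
begin

text \<open>The lattice \<open>\<int>\<^sup>d\<close> is the type \<open>int ^ 'd\<close>, with \<open>d = CARD('d)\<close>.\<close>

definition lattice_norm :: "int ^ 'd::finite \<Rightarrow> real" where
  "lattice_norm z = norm (\<chi> i. real_of_int (z $ i))"

definition generator :: "(int ^ 'd::finite \<Rightarrow> real) \<Rightarrow> (int ^ 'd \<Rightarrow> complex) \<Rightarrow> int ^ 'd \<Rightarrow> complex" where
  "generator a f x = (\<Sum>\<^sub>\<infinity>z\<in>-{0}. of_real (a z) * (f (x + z) - f x))"

definition correlation :: "(int ^ 'd::finite \<Rightarrow> real) \<Rightarrow> int ^ 'd \<Rightarrow> real" where
  "correlation b x = (\<Sum>\<^sub>\<infinity>z. b (x - z) * b (- z))"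

definition H2 ::
  "real \<Rightarrow> (int ^ 'd::finite \<Rightarrow> real) \<Rightarrow> (int ^ 'd \<Rightarrow> real) \<Rightarrow> (int ^ 'd \<Rightarrow> complex) \<Rightarrow> int ^ 'd \<Rightarrow> complex" where
  "H2 \<kappa> a B f x = of_real (2 * \<kappa>) * generator a f x + of_real (B x) * f x"

definition l2 :: "('a \<Rightarrow> complex) set" where
  "l2 = {f. (\<lambda>x. (cmod (f x))\<^sup>2) summable_on UNIV}"

interpretation cfun: vector_space "\<lambda>(c::complex) (f :: 'a \<Rightarrow> complex) x. c * f x"
  by unfold_locales (auto simp: algebra_simps fun_eq_iff)

definition eigenspace :: "(('a \<Rightarrow> complex) \<Rightarrow> 'a \<Rightarrow> complex) \<Rightarrow> real \<Rightarrow> ('a \<Rightarrow> complex) set" where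
  "eigenspace T \<mu> = {f \<in> l2. \<forall>x. T f x = of_real \<mu> * f x}"

definition eigenvalue :: "(('a \<Rightarrow> complex) \<Rightarrow> 'a \<Rightarrow> complex) \<Rightarrow> real \<Rightarrow> bool" where
  "eigenvalue T \<mu> \<longleftrightarrow> (\<exists>f\<in>eigenspace T \<mu>. f \<noteq> 0)"

text \<open>The complex dimension of the eigenspace. The library's \<open>dim\<close> is not used because it takes
  values in \<open>nat\<close> and is a junk value on infinite-dimensional spaces.\<close>

definition eigen_multiplicity :: "(('a \<Rightarrow> complex) \<Rightarrow> 'a \<Rightarrow> complex) \<Rightarrow> real \<Rightarrow> enat" where
  "eigen_multiplicity T \<mu> =
     (SUP S \<in> {S. finite S \<and> S \<subseteq> eigenspace T \<mu> \<and> cfun.independent S}. enat (card S))"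

text \<open>Infinite sums in \<open>enat\<close> always converge. Only real eigenvalues are considered, since
  the operator is self-adjoint.\<close>

definition num_pos_eigenvalues :: "(('a \<Rightarrow> complex) \<Rightarrow> 'a \<Rightarrow> complex) \<Rightarrow> enat" where
  "num_pos_eigenvalues T = (\<Sum>\<^sub>\<infinity>\<mu>\<in>{\<mu>. 0 < \<mu> \<and> eigenvalue T \<mu>}. eigen_multiplicity T \<mu>)"

end

theory Submission
  imports Defs
begin

text \<open>Write \<open>E(f) = -\<langle>\<A>f, f\<rangle> = 1/2 \<Sum>\<^sub>x \<Sum>\<^sub>z a(z) (f(x + z) - f(x))\<^sup>2\<close> for the Dirichlet form of the walk, so
that \<open>\<langle>\<H>\<^sub>2f, f\<rangle> = \<Sum>\<^sub>x B(x) f(x)\<^sup>2 - 2\<kappa> E(f)\<close> for real finitely supported \<open>f\<close>. Let \<open>P\<close> be the set of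
those \<open>\<kappa> > 0\<close> for which this quadratic form takes a positive value. Since \<open>E \<ge> 0\<close>, the set \<open>P\<close> is
closed downwards, and it contains \<open>B(0)/4\<close>, as the point mass at \<open>0\<close> shows. The critical value is
\<open>sup P\<close>, and two facts remain.

A positive eigenvalue exists if and only if \<open>\<kappa> \<in> P\<close> (\<open>positive_eigenvalue_iff\<close>). If \<open>f\<close> is an
eigenfunction with eigenvalue \<open>\<mu> > 0\<close>, its real or imaginary part is nonzero, and the quadratic form
at its restriction to a large finite set is close to \<open>\<mu>\<close> times the squared norm
(\<open>truncated_eigenvector_positive\<close>). Conversely, the supremum \<open>\<mu>\<close> of the form on finitely supported
unit vectors is finite, and it is positive if \<open>\<kappa> \<in> P\<close>. By the Cauchy--Schwarz inequality for the
positive semidefinite form \<open>\<mu> - \<H>\<^sub>2\<close>, a maximising sequence \<open>f\<^sub>n\<close> satisfies \<open>(\<mu> - \<H>\<^sub>2)f\<^sub>n(x) \<rightarrow> 0\<close> for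
every \<open>x\<close>. A pointwise convergent subsequence therefore has a limit \<open>u\<close> with \<open>\<H>\<^sub>2u = \<mu>u\<close>. The limit is not
zero: \<open>\<Sum>\<^sub>x B(x) f\<^sub>n(x)\<^sup>2 \<ge> \<langle>\<H>\<^sub>2f\<^sub>n, f\<^sub>n\<rangle> \<rightarrow> \<mu>\<close>, while \<open>B \<ge> \<mu>/4\<close> holds at finitely many sites only, so a
fixed finite set keeps a fixed part of the mass (\<open>positive_eigenvector_exists\<close>).

The set \<open>P\<close> is bounded, because the walk is transient for \<open>d \<ge> 3\<close>: there is a constant \<open>C\<close> with
\<open>f(x)\<^sup>2 \<le> C E(f)\<close> for all \<open>x\<close> and all finitely supported \<open>f\<close> (\<open>lattice_transience\<close>). As
\<open>\<Sum>\<^sub>x B(x) \<le> (\<Sum>\<^sub>z |b(z)|)\<^sup>2 =: M\<close>, this yields \<open>\<langle>\<H>\<^sub>2f, f\<rangle> \<le> (M C - 2\<kappa>) E(f)\<close>, so \<open>\<kappa> \<le> M C / 2\<close> on \<open>P\<close>.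
The inequality \<open>f(x)\<^sup>2 \<le> C E(f)\<close> is proved with a unit flow of finite energy from \<open>x\<close> to infinity
inside a three-dimensional octant with corner \<open>x\<close>: the flow of the Polya urn that starts with one ball
of each of three colours. Only jumps by three unit vectors enter.\<close>

section \<open>A unit flow of finite energy in the octant\<close>

text \<open>The pairing of a flow \<open>h\<close> along the half-line with the decrements of \<open>u\<close> equals the pairing of the
divergence of \<open>h\<close> with \<open>u\<close>. Here \<open>g\<close> is \<open>h\<close> shifted by one, that is, the flow into a site.\<close>

lemma sum_by_parts_vanishing:
  fixes g h u :: "nat \<Rightarrow> real"
  assumes "g 0 = 0" "\<And>i. g (Suc i) = h i" "u N = 0"
  shows "(\<Sum>i<N. h i * (u i - u (Suc i))) = (\<Sum>i<N. (h i - g i) * u i)"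
proof -
  have "(\<Sum>i<n. h i * (u i - u (Suc i))) = (\<Sum>i<n. (h i - g i) * u i) - g n * u n" for n
    by (induction n) (simp_all add: assms(1,2) algebra_simps)
  then show ?thesis
    using assms(3) by simp
qed

lemma sum_le_telescoping:
  fixes f F :: "nat \<Rightarrow> real"
  assumes "\<And>i. f i \<le> F i - F (Suc i)" "\<And>i. 0 \<le> F i"
  shows "(\<Sum>i<N. f i) \<le> F 0"
proof -
  have "(\<Sum>i<N. f i) \<le> (\<Sum>i<N. F i - F (Suc i))"
    by (intro sum_mono assms)
  also have "\<dots> = F 0 - F N"
    by (rule sum_lessThan_telescope')
  finally show ?thesis
    using assms(2)[of N] by linarith
qed

text \<open>The summand dominates the squared flow through an edge that leaves \<open>(i, j, k)\<close>. It is at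
most \<open>24 / ((n + 1)(n + 2)(n + 3)(n + 4))\<close> with \<open>n = i + j + k\<close>, whose iterated sums telescope.\<close>

lemma octant_sum_bound:
  "(\<Sum>i<N. \<Sum>j<N. \<Sum>k<N. (2 / ((real (i + j + k) + 1) * (real (i + j + k) + 2)))\<^sup>2) \<le> 4"
proof -
  have k: "(\<Sum>k<N. (2 / ((real (s + k) + 1) * (real (s + k) + 2)))\<^sup>2)
      \<le> 8 / ((real s + 1) * (real s + 2) * (real s + 3))" for s
  proof -
    have "(2 / ((m + 1) * (m + 2)))\<^sup>2
        \<le> 8 / ((m + 1) * (m + 2) * (m + 3)) - 8 / ((m + 2) * (m + 3) * (m + 4))"
      if "0 \<le> m" for m :: real
    proof -
      have "(2 / ((m + 1) * (m + 2)))\<^sup>2 = 4 / (((m + 1) * (m + 2)) * ((m + 1) * (m + 2)))"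
        by (simp add: power2_eq_square)
      also have "\<dots> \<le> 24 / (((m + 1) * (m + 2)) * ((m + 3) * (m + 4)))"
      proof -
        have "4 * ((m + 3) * (m + 4)) \<le> 24 * ((m + 1) * (m + 2))"
        proof -
          have "0 \<le> 20 * (m * m) + 44 * m"
            using that by simp
          then show ?thesis
            by (simp add: algebra_simps)
        qed
        then have "4 * ((m + 3) * (m + 4)) * ((m + 1) * (m + 2)) \<le> 24 * ((m + 1) * (m + 2)) * ((m + 1) * (m + 2))"
          using that by (intro mult_right_mono) auto
        then show ?thesis
          using that by (simp add: pos_divide_le_eq pos_le_divide_eq mult_ac)
      qed
      also have "\<dots> = 8 / ((m + 1) * (m + 2) * (m + 3)) - 8 / ((m + 2) * (m + 3) * (m + 4))"
        using that by (simp add: divide_simps) 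
      finally show ?thesis .
    qed
    from this[of "real (s + _)"] show ?thesis
      using sum_le_telescoping[of "\<lambda>k. (2 / ((real (s + k) + 1) * (real (s + k) + 2)))\<^sup>2"
          "\<lambda>k. 8 / ((real (s + k) + 1) * (real (s + k) + 2) * (real (s + k) + 3))" N]
      by (simp add: add_ac)
  qed
  have j: "(\<Sum>j<N. 8 / ((real (s + j) + 1) * (real (s + j) + 2) * (real (s + j) + 3)))
      \<le> 4 / ((real s + 1) * (real s + 2))" for s
  proof -
    have "8 / ((m + 1) * (m + 2) * (m + 3)) = 4 / ((m + 1) * (m + 2)) - 4 / ((m + 2) * (m + 3))"
      if "0 \<le> m" for m :: real
      using that by (simp add: divide_simps) 
    from this[of "real (s + _)"] show ?thesis
      using sum_le_telescoping[of "\<lambda>j. 8 / ((real (s + j) + 1) * (real (s + j) + 2) * (real (s + j) + 3))"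
          "\<lambda>j. 4 / ((real (s + j) + 1) * (real (s + j) + 2))" N]
      by (simp add: add_ac)
  qed
  have i: "(\<Sum>i<N. 4 / ((real i + 1) * (real i + 2))) \<le> 4"
  proof -
    have "4 / ((m + 1) * (m + 2)) = 4 / (m + 1) - 4 / (m + 2)" if "0 \<le> m" for m :: real
      using that by (simp add: divide_simps) 
    from this[of "real _"] show ?thesis
      using sum_le_telescoping[of "\<lambda>i. 4 / ((real i + 1) * (real i + 2))"
          "\<lambda>i. 4 / (real i + 1)" N]
      by (simp add: add_ac)
  qed
  have "(\<Sum>i<N. \<Sum>j<N. \<Sum>k<N. (2 / ((real (i + j + k) + 1) * (real (i + j + k) + 2)))\<^sup>2)
      \<le> (\<Sum>i<N. \<Sum>j<N. 8 / ((real (i + j) + 1) * (real (i + j) + 2) * (real (i + j) + 3)))"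
    by (intro sum_mono k)
  also have "\<dots> \<le> (\<Sum>i<N. 4 / ((real i + 1) * (real i + 2)))"
    by (intro sum_mono j)
  finally show ?thesis
    using i by linarith
qed

text \<open>The urn flow: \<open>urn_flow i n\<close> is the flow into a site of the octant at level \<open>n\<close> (the sum of its three
coordinates) through the edge in a direction in which the site has coordinate \<open>i\<close>. A Polya urn with
one ball of each colour at the start is uniformly distributed on the \<open>n (n + 1) / 2\<close> sites of level
\<open>n - 1\<close>, and from there coordinate \<open>i - 1\<close> increases with probability \<open>i / (n + 2)\<close>. At \<open>n = 0\<close>
the division by zero gives the value \<open>0\<close>, which is the inflow at the corner.\<close>

definition urn_flow :: "nat \<Rightarrow> nat \<Rightarrow> real" where
  "urn_flow i n = 2 * real i / (real n * (real n + 1) * (real n + 2))"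

text \<open>Outflow minus inflow: the urn flow has a unit source at the corner and none elsewhere.\<close>

lemma urn_flow_divergence:
  "(urn_flow (Suc i) (Suc (i + j + k)) - urn_flow i (i + j + k))
   + (urn_flow (Suc j) (Suc (i + j + k)) - urn_flow j (i + j + k))
   + (urn_flow (Suc k) (Suc (i + j + k)) - urn_flow k (i + j + k))
   = (if i = 0 \<and> j = 0 \<and> k = 0 then 1 else 0)"
proof (cases "i + j + k = 0")
  case True
  then show ?thesis
    by (simp add: urn_flow_def)
next
  case False
  define m where "m = real (i + j + k)"
  have m: "0 < m" "m = real i + real j + real k"
    using False by (auto simp: m_def)
  have "urn_flow (Suc i) (Suc (i + j + k)) + urn_flow (Suc j) (Suc (i + j + k))
      + urn_flow (Suc k) (Suc (i + j + k)) = 2 * (m + 3) / ((m + 1) * (m + 2) * (m + 3))"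
    unfolding urn_flow_def m_def by (simp add: add_divide_distrib[symmetric] add_ac)
  also have "\<dots> = 2 * m / (m * (m + 1) * (m + 2))"
    using m(1) by (simp add: divide_simps)
  also have "\<dots> = urn_flow i (i + j + k) + urn_flow j (i + j + k) + urn_flow k (i + j + k)"
    unfolding urn_flow_def m_def by (simp add: add_divide_distrib[symmetric] algebra_simps)
  finally show ?thesis
    using False by auto
qed

lemma urn_flow_bound:
  assumes "i \<le> n"
  shows "(urn_flow (Suc i) (Suc n))\<^sup>2 \<le> (2 / ((real n + 1) * (real n + 2)))\<^sup>2"
proof -
  have "urn_flow (Suc i) (Suc n) = (real i + 1) / (real n + 3) * (2 / ((real n + 1) * (real n + 2)))"
    unfolding urn_flow_def by (simp add: divide_simps add_ac)
  also have "\<dots> \<le> 1 * (2 / ((real n + 1) * (real n + 2)))"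
    using assms by (intro mult_right_mono) (auto simp: divide_simps)
  finally show ?thesis
    by (intro power_mono) (auto simp: urn_flow_def)
qed

lemma triple_sum_Cauchy_Schwarz:
  fixes f g :: "nat \<Rightarrow> nat \<Rightarrow> nat \<Rightarrow> real"
  shows "(\<Sum>i<N. \<Sum>j<N. \<Sum>k<N. f i j k * g i j k)\<^sup>2
    \<le> (\<Sum>i<N. \<Sum>j<N. \<Sum>k<N. (f i j k)\<^sup>2) * (\<Sum>i<N. \<Sum>j<N. \<Sum>k<N. (g i j k)\<^sup>2)"
  using Cauchy_Schwarz_ineq_sum[of "\<lambda>(i, j, k). f i j k" "\<lambda>(i, j, k). g i j k"
      "{..<N} \<times> {..<N} \<times> {..<N}"]
  by (simp add: sum.cartesian_product case_prod_unfold)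

text \<open>The value at the corner is the pairing of the urn flow with the decrements of \<open>u\<close>, and the
Cauchy--Schwarz inequality bounds it by the energy of the flow times that of \<open>u\<close>.\<close>

lemma octant_transience:
  fixes u :: "nat \<Rightarrow> nat \<Rightarrow> nat \<Rightarrow> real"
  assumes vanish: "\<And>i j k. N \<le> i \<or> N \<le> j \<or> N \<le> k \<Longrightarrow> u i j k = 0"
  shows "(u 0 0 0)\<^sup>2 \<le> 12 *
    ((\<Sum>i<N. \<Sum>j<N. \<Sum>k<N. (u i j k - u (Suc i) j k)\<^sup>2)
     + (\<Sum>i<N. \<Sum>j<N. \<Sum>k<N. (u i j k - u i (Suc j) k)\<^sup>2)
     + (\<Sum>i<N. \<Sum>j<N. \<Sum>k<N. (u i j k - u i j (Suc k))\<^sup>2))"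
    (is "_ \<le> 12 * (?G1 + ?G2 + ?G3)")
proof -
  define A1 where "A1 = (\<Sum>i<N. \<Sum>j<N. \<Sum>k<N.
    urn_flow (Suc i) (Suc (i + j + k)) * (u i j k - u (Suc i) j k))"
  define A2 where "A2 = (\<Sum>i<N. \<Sum>j<N. \<Sum>k<N.
    urn_flow (Suc j) (Suc (i + j + k)) * (u i j k - u i (Suc j) k))"
  define A3 where "A3 = (\<Sum>i<N. \<Sum>j<N. \<Sum>k<N.
    urn_flow (Suc k) (Suc (i + j + k)) * (u i j k - u i j (Suc k)))"
  have A3': "A3 = (\<Sum>i<N. \<Sum>j<N. \<Sum>k<N.
      (urn_flow (Suc k) (Suc (i + j + k)) - urn_flow k (i + j + k)) * u i j k)"
    unfolding A3_def
    by (intro sum.cong refl sum_by_parts_vanishing) (auto simp: urn_flow_def vanish)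
  have "A2 = (\<Sum>i<N. \<Sum>k<N. \<Sum>j<N.
      urn_flow (Suc j) (Suc (i + j + k)) * (u i j k - u i (Suc j) k))"
    unfolding A2_def by (intro sum.cong refl sum.swap)
  also have "\<dots> = (\<Sum>i<N. \<Sum>k<N. \<Sum>j<N.
      (urn_flow (Suc j) (Suc (i + j + k)) - urn_flow j (i + j + k)) * u i j k)"
    by (intro sum.cong refl sum_by_parts_vanishing) (auto simp: urn_flow_def vanish)
  also have "\<dots> = (\<Sum>i<N. \<Sum>j<N. \<Sum>k<N.
      (urn_flow (Suc j) (Suc (i + j + k)) - urn_flow j (i + j + k)) * u i j k)"
    by (intro sum.cong refl sum.swap)
  finally have A2': "A2 = \<dots>" .
  have rot: "(\<Sum>i<N. \<Sum>j<N. \<Sum>k<N. f i j k) = (\<Sum>j<N. \<Sum>k<N. \<Sum>i<N. f i j k)"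
    for f :: "nat \<Rightarrow> nat \<Rightarrow> nat \<Rightarrow> real"
    by (subst sum.swap) (intro sum.cong refl sum.swap)
  have A1': "A1 = (\<Sum>i<N. \<Sum>j<N. \<Sum>k<N.
      (urn_flow (Suc i) (Suc (i + j + k)) - urn_flow i (i + j + k)) * u i j k)"
    unfolding A1_def rot[of "\<lambda>i j k. urn_flow (Suc i) (Suc (i + j + k)) * (u i j k - u (Suc i) j k)"]
      rot[of "\<lambda>i j k. (urn_flow (Suc i) (Suc (i + j + k)) - urn_flow i (i + j + k)) * u i j k"]
    by (intro sum.cong refl sum_by_parts_vanishing) (auto simp: urn_flow_def vanish)
  have "A1 + A2 + A3 = (\<Sum>i<N. \<Sum>j<N. \<Sum>k<N.
      (if i = 0 \<and> j = 0 \<and> k = 0 then 1 else 0) * u i j k)"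
    unfolding A1' A2' A3' sum.distrib[symmetric] distrib_right[symmetric] urn_flow_divergence ..
  also have "\<dots> = (\<Sum>i<N. \<Sum>j<N. \<Sum>k<N.
      if k = 0 then if j = 0 then if i = 0 then u i j k else 0 else 0 else 0)"
    by (intro sum.cong refl) auto
  also have "\<dots> = u 0 0 0"
    using vanish[of 0 0 0] by (cases N) auto
  finally have eq: "u 0 0 0 = A1 + A2 + A3" ..
  have bound: "X\<^sup>2 \<le> 4 * G"
    if "X\<^sup>2 \<le> (\<Sum>i<N. \<Sum>j<N. \<Sum>k<N. (urn_flow (Suc (p i j k)) (Suc (i + j + k)))\<^sup>2) * G" "0 \<le> G"
      "\<And>i j k. p i j k \<le> i + j + k" for X G p
  proof -
    have "(\<Sum>i<N. \<Sum>j<N. \<Sum>k<N. (urn_flow (Suc (p i j k)) (Suc (i + j + k)))\<^sup>2)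
        \<le> (\<Sum>i<N. \<Sum>j<N. \<Sum>k<N. (2 / ((real (i + j + k) + 1) * (real (i + j + k) + 2)))\<^sup>2)"
      by (intro sum_mono urn_flow_bound that)
    also have "\<dots> \<le> 4"
      by (rule octant_sum_bound)
    finally show ?thesis
      using that(1,2) mult_right_mono order_trans by blast
  qed
  have "A1\<^sup>2 \<le> 4 * ?G1" "A2\<^sup>2 \<le> 4 * ?G2" "A3\<^sup>2 \<le> 4 * ?G3"
    unfolding A1_def A2_def A3_def
    by (rule bound[OF triple_sum_Cauchy_Schwarz]; (intro sum_nonneg)?; simp)+
  moreover have "(A1 + A2 + A3)\<^sup>2 \<le> 3 * (A1\<^sup>2 + A2\<^sup>2 + A3\<^sup>2)"
    using sum_squares_ge_zero[of "A1 - A2" "A2 - A3"] zero_le_power2[of "A1 - A3"]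
    by (simp add: power2_eq_square algebra_simps)
  ultimately show ?thesis
    unfolding eq by argo
qed

section \<open>Maximising a quadratic form that is dominated by a decaying potential\<close>

lemma has_sum_finite_support:
  fixes f :: "'a \<Rightarrow> real"
  assumes "finite S" "\<And>x. x \<notin> S \<Longrightarrow> f x = 0"
  shows "(f has_sum sum f S) UNIV"
  using assms by (intro has_sum_finite_neutralI) auto

lemma has_sum_sum:
  fixes f :: "'i \<Rightarrow> 'a \<Rightarrow> real"
  assumes "\<And>i. i \<in> I \<Longrightarrow> (f i has_sum s i) A"
  shows "((\<lambda>x. \<Sum>i\<in>I. f i x) has_sum (\<Sum>i\<in>I. s i)) A"
  using assms by (induction I rule: infinite_finite_induct) (auto intro: has_sum_add)

text \<open>Dominated convergence, in the direction that identifies the sum of the limit.\<close>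

lemma has_sum_dominated_tendsto:
  fixes k :: "'a \<Rightarrow> real" and g :: "nat \<Rightarrow> 'a \<Rightarrow> real"
  assumes k: "(\<lambda>y. \<bar>k y\<bar>) summable_on UNIV"
    and g: "\<And>n y. \<bar>g n y\<bar> \<le> 1"
    and lim: "\<And>y. (\<lambda>n. g n y) \<longlonglongrightarrow> h y"
    and sums: "\<And>n. ((\<lambda>y. k y * g n y) has_sum s n) UNIV"
    and s: "s \<longlonglongrightarrow> l"
  shows "((\<lambda>y. k y * h y) has_sum l) UNIV"
proof -
  have h: "\<bar>h y\<bar> \<le> 1" for y
    using lim[of y] g by (intro LIMSEQ_le_const2[OF tendsto_rabs]) auto
  have sk: "(\<lambda>y. \<bar>k y * f y\<bar>) summable_on UNIV" if "\<And>y. \<bar>f y\<bar> \<le> 1" for f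
    by (rule summable_on_comparison_test[OF k]) (use that in \<open>auto simp: abs_mult intro: mult_left_le\<close>)
  have sum_h: "(\<lambda>y. k y * h y) summable_on UNIV"
    using sk[OF h] summable_on_iff_abs_summable_on_real[of "\<lambda>y. k y * h y"] by simp
  define t where "t = infsum (\<lambda>y. k y * h y) UNIV"
  have t: "((\<lambda>y. k y * h y) has_sum t) UNIV"
    unfolding t_def using sum_h by simp
  have "s \<longlonglongrightarrow> t"
  proof (rule LIMSEQ_I)
    fix \<epsilon> :: real assume \<epsilon>: "0 < \<epsilon>"
    obtain F where F: "finite F" "dist (\<Sum>y\<in>F. \<bar>k y\<bar>) (infsum (\<lambda>y. \<bar>k y\<bar>) UNIV) \<le> \<epsilon> / 5"
      using infsum_finite_approximation[OF k, of "\<epsilon> / 5"] \<epsilon> by auto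
    have tail: "\<bar>r - (\<Sum>y\<in>F. k y * f y)\<bar> \<le> \<epsilon> / 5"
      if f: "\<And>y. \<bar>f y\<bar> \<le> 1" and r: "((\<lambda>y. k y * f y) has_sum r) UNIV" for f r
    proof -
      have 1: "((\<lambda>y. k y * f y) has_sum (r - (\<Sum>y\<in>F. k y * f y))) (UNIV - F)"
        using has_sum_Diff[OF r has_sum_finite[OF F(1)]] by simp
      have 2: "((\<lambda>y. \<bar>k y\<bar>) has_sum (infsum (\<lambda>y. \<bar>k y\<bar>) UNIV - (\<Sum>y\<in>F. \<bar>k y\<bar>))) (UNIV - F)"
        using has_sum_Diff[OF has_sum_infsum[OF k] has_sum_finite[OF F(1)]] by simp
      have "norm (r - (\<Sum>y\<in>F. k y * f y)) \<le> infsum (\<lambda>y. \<bar>k y\<bar>) UNIV - (\<Sum>y\<in>F. \<bar>k y\<bar>)"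
        by (rule norm_infsum_le[OF 1 2]) (simp add: abs_mult mult_left_le f)
      then show ?thesis
        using F(2) by (simp add: dist_real_def)
    qed
    have "(\<lambda>n. \<Sum>y\<in>F. k y * g n y) \<longlonglongrightarrow> (\<Sum>y\<in>F. k y * h y)"
      by (intro tendsto_intros lim)
    from LIMSEQ_D[OF this, of "\<epsilon> / 5"] \<epsilon> obtain M where
      M: "\<And>n. n \<ge> M \<Longrightarrow> norm ((\<Sum>y\<in>F. k y * g n y) - (\<Sum>y\<in>F. k y * h y)) < \<epsilon> / 5"
      by auto
    show "\<exists>no. \<forall>n\<ge>no. norm (s n - t) < \<epsilon>"
    proof (intro exI allI impI)
      fix n assume "M \<le> n"
      from M[OF this] tail[OF g sums, of n] tail[OF h t] show "norm (s n - t) < \<epsilon>"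
        using \<epsilon> unfolding real_norm_def by linarith
    qed
  qed
  then have "t = l"
    using s LIMSEQ_unique by blast
  then show ?thesis
    using t by simp
qed

lemma bounded_pointwise_subsequence:
  fixes f :: "nat \<Rightarrow> 'a::countable \<Rightarrow> real"
  assumes "\<And>n x. \<bar>f n x\<bar> \<le> 1"
  obtains r u where "strict_mono r" "\<And>x. (\<lambda>n. f (r n) x) \<longlonglongrightarrow> u x"
proof -
  have "compactin (product_topology (\<lambda>_. euclidean) UNIV) (PiE UNIV (\<lambda>_::'a. {-1..1::real}))"
    by (subst compactin_PiE) auto
  then have "compact (PiE UNIV (\<lambda>_::'a. {-1..1::real}))"
    by (simp add: euclidean_product_topology)
  then have "seq_compact (PiE UNIV (\<lambda>_::'a. {-1..1::real}))"
    by (rule compact_imp_seq_compact)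
  moreover have "f n \<in> PiE UNIV (\<lambda>_::'a. {-1..1::real})" for n
    using assms[of n] by (auto simp: abs_le_iff minus_le_iff)
  ultimately obtain u r where "strict_mono r" "(f \<circ> r) \<longlonglongrightarrow> u"
    unfolding seq_compact_def by metis
  moreover have "(\<lambda>n. f (r n) x) \<longlonglongrightarrow> u x" for x
    using continuous_on_tendsto_compose[OF continuous_on_product_coordinates \<open>(f \<circ> r) \<longlonglongrightarrow> u\<close>, of x]
    by (simp add: o_def)
  ultimately show thesis
    using that by blast
qed

text \<open>The quadratic form of a kernel \<open>K\<close> on functions restricted to the finite set \<open>S\<close>. Finitely supported
functions are represented by a function together with a finite set, and only the values on that set
matter.\<close>

definition quad_form :: "('a \<Rightarrow> 'a \<Rightarrow> real) \<Rightarrow> 'a set \<Rightarrow> ('a \<Rightarrow> real) \<Rightarrow> real" where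
  "quad_form K S f = (\<Sum>x\<in>S. \<Sum>y\<in>S. K x y * f x * f y)"

lemma quad_form_mono_neutral:
  assumes "finite T" "S \<subseteq> T" "\<And>x. x \<in> T - S \<Longrightarrow> f x = 0"
  shows "quad_form K T f = quad_form K S f"
proof -
  have "quad_form K T f = (\<Sum>x\<in>S. \<Sum>y\<in>T. K x y * f x * f y)"
    unfolding quad_form_def
    by (rule sum.mono_neutral_right) (use assms in auto)
  also have "\<dots> = quad_form K S f"
    unfolding quad_form_def
    by (intro sum.cong refl sum.mono_neutral_right) (use assms in auto)
  finally show ?thesis .
qed

lemma quad_form_scale: "quad_form K S (\<lambda>x. c * f x) = c\<^sup>2 * quad_form K S f"
  unfolding quad_form_def sum_distrib_left by (simp add: power2_eq_square mult_ac)

lemma quad_form_add_point: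
  fixes K :: "'a \<Rightarrow> 'a \<Rightarrow> real"
  assumes S: "finite S" "w \<in> S" and sym: "\<And>x y. K x y = K y x"
  shows "quad_form K S (\<lambda>x. f x + t * of_bool (x = w))
    = quad_form K S f + 2 * t * (\<Sum>y\<in>S. K w y * f y) + t\<^sup>2 * K w w"
proof -
  have "quad_form K S (\<lambda>x. f x + t * of_bool (x = w))
    = (\<Sum>x\<in>S. \<Sum>y\<in>S. K x y * f x * f y + (if y = w then t * K x w * f x else 0)
        + (if x = w then t * K w y * f y else 0)
        + (if x = w then if y = w then t\<^sup>2 * K w w else 0 else 0))"
    unfolding quad_form_def by (intro sum.cong refl) (auto simp: algebra_simps power2_eq_square)
  also have "\<dots> = quad_form K S f + (\<Sum>x\<in>S. t * K x w * f x) + (\<Sum>y\<in>S. t * K w y * f y) + t\<^sup>2 * K w w"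
  proof -
    have "(\<Sum>x\<in>S. \<Sum>y\<in>S. if x = w then t * K w y * f y else 0)
      = (\<Sum>y\<in>S. t * K w y * f y)"
      by (subst sum.swap) (use S in simp)
    moreover have "(\<Sum>x\<in>S. \<Sum>y\<in>S. if x = w then if y = w then t\<^sup>2 * K w w else 0 else 0) = t\<^sup>2 * K w w"
      by (subst sum.swap) (use S in simp)
    ultimately show ?thesis
      using S by (simp add: sum.distrib quad_form_def)
  qed
  also have "(\<Sum>x\<in>S. t * K x w * f x) = (\<Sum>y\<in>S. t * K w y * f y)"
    by (simp add: sym)
  finally show ?thesis
    by (simp add: sum_distrib_left mult_ac)
qed

text \<open>The Cauchy--Schwarz inequality between \<open>f\<close> and the point mass at \<open>w\<close>. The constant \<open>K w w + 1\<close> replaces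
the sharp \<open>K w w\<close>, so that no separate argument is needed for \<open>K w w = 0\<close>.\<close>

lemma quad_form_Cauchy_Schwarz:
  fixes K :: "'a \<Rightarrow> 'a \<Rightarrow> real"
  assumes S: "finite S" "w \<in> S" and sym: "\<And>x y. K x y = K y x"
    and nonneg: "\<And>g. 0 \<le> quad_form K S g"
  shows "(\<Sum>y\<in>S. K w y * f y)\<^sup>2 \<le> (K w w + 1) * quad_form K S f"
proof -
  define l where "l = (\<Sum>y\<in>S. K w y * f y)"
  have ineq: "0 \<le> quad_form K S f + 2 * t * l + t\<^sup>2 * K w w" for t
    using nonneg[of "\<lambda>x. f x + t * of_bool (x = w)"] quad_form_add_point[OF S sym]
    by (simp add: l_def)
  have "0 \<le> quad_form K S (\<lambda>x. of_bool (x = w))" by (rule nonneg)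
  also have "\<dots> = K w w"
    using quad_form_add_point[OF S sym, where f = "\<lambda>_. 0" and t = 1] by (simp add: quad_form_def)
  finally have c: "0 \<le> K w w" .
  \<comment> \<open>Near-optimal choice of \<open>t\<close>: the minimiser would be \<open>- l / K w w\<close>.\<close>
  have "0 \<le> quad_form K S f - 2 * (l\<^sup>2 / (K w w + 1)) + l\<^sup>2 / (K w w + 1) * (K w w / (K w w + 1))"
    using ineq[of "- l / (K w w + 1)"] by (simp add: power2_eq_square)
  also have "l\<^sup>2 / (K w w + 1) * (K w w / (K w w + 1)) \<le> l\<^sup>2 / (K w w + 1) * 1"
    using c by (intro mult_left_mono) auto
  finally have "l\<^sup>2 / (K w w + 1) \<le> quad_form K S f"
    by simp
  then show ?thesis
    using c by (simp add: l_def pos_divide_le_eq mult.commute)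
qed

lemma inverse_Suc_tendsto_0: "(\<lambda>n. 1 / (real n + 1)) \<longlonglongrightarrow> 0"
  using LIMSEQ_Suc[OF lim_1_over_n] by (simp add: add.commute)

text \<open>If a symmetric kernel with summable rows is dominated as a form by a potential \<open>B \<ge> 0\<close> that tends to zero at infinity,
positivity of the form somewhere forces a square-summable eigenvector with positive eigenvalue.\<close>

lemma positive_eigenvector_exists:
  fixes K :: "'a::countable \<Rightarrow> 'a \<Rightarrow> real"
  assumes sym: "\<And>x y. K x y = K y x"
    and summ: "\<And>x. (\<lambda>y. \<bar>K x y\<bar>) summable_on UNIV"
    and upper: "\<And>S f. finite S \<Longrightarrow> quad_form K S f \<le> (\<Sum>x\<in>S. B x * (f x)\<^sup>2)"
    and B_nonneg: "\<And>x. 0 \<le> B x"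
    and B_fin: "\<And>\<delta>. 0 < \<delta> \<Longrightarrow> finite {x. \<delta> \<le> B x}"
    and pos: "finite S0" "0 < quad_form K S0 f0"
  shows "\<exists>\<mu>>0. \<exists>u. (\<exists>x. u x \<noteq> 0) \<and> (\<lambda>x. (u x)\<^sup>2) summable_on UNIV
    \<and> (\<forall>x. ((\<lambda>y. K x y * u y) has_sum (\<mu> * u x)) UNIV)"
proof -
  define V where "V = {quad_form K S f | S f. finite S \<and> (\<Sum>x\<in>S. (f x)\<^sup>2) = 1}"
  define \<mu> where "\<mu> = Sup V"
  define M where "M = 1 + (\<Sum>x | 1 \<le> B x. B x)"
  have B_le: "B x \<le> M" for x
  proof (cases "1 \<le> B x")
    case True
    then have "B x \<le> (\<Sum>x | 1 \<le> B x. B x)"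
      using B_fin[of 1] B_nonneg by (intro member_le_sum) auto
    then show ?thesis
      by (simp add: M_def)
  next
    case False
    moreover have "0 \<le> (\<Sum>x | 1 \<le> B x. B x)"
      by (intro sum_nonneg B_nonneg)
    ultimately show ?thesis
      by (simp add: M_def)
  qed
  have bdd: "bdd_above V"
  proof (rule bdd_aboveI)
    fix v assume "v \<in> V"
    then obtain S f where v: "v = quad_form K S f" "finite S" "(\<Sum>x\<in>S. (f x)\<^sup>2) = 1"
      by (auto simp: V_def)
    have "v \<le> (\<Sum>x\<in>S. B x * (f x)\<^sup>2)"
      unfolding v(1) by (rule upper[OF v(2)])
    also have "\<dots> \<le> (\<Sum>x\<in>S. M * (f x)\<^sup>2)"
      by (intro sum_mono mult_right_mono B_le) auto
    also have "\<dots> = M"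
      using v(3) by (simp add: sum_distrib_left[symmetric])
    finally show "v \<le> M" .
  qed
  have ub: "quad_form K S f \<le> \<mu> * (\<Sum>x\<in>S. (f x)\<^sup>2)" if S: "finite S" for S f
  proof (cases "(\<Sum>x\<in>S. (f x)\<^sup>2) = 0")
    case True
    then have "\<And>x. x \<in> S \<Longrightarrow> f x = 0"
      using S by (simp add: sum_nonneg_eq_0_iff)
    then show ?thesis
      using True by (simp add: quad_form_def)
  next
    case False
    define N where "N = (\<Sum>x\<in>S. (f x)\<^sup>2)"
    have "0 \<le> N"
      unfolding N_def by (intro sum_nonneg) auto
    then have N: "0 < N"
      using False by (simp add: N_def)
    have "(\<Sum>x\<in>S. (1 / sqrt N * f x)\<^sup>2) = (1 / sqrt N)\<^sup>2 * N"
      unfolding N_def power_mult_distrib sum_distrib_left ..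
    also have "\<dots> = 1"
      using N by (simp add: power_divide)
    finally have "quad_form K S (\<lambda>x. 1 / sqrt N * f x) \<in> V"
      using S unfolding V_def by blast
    then have "quad_form K S (\<lambda>x. 1 / sqrt N * f x) \<le> \<mu>"
      unfolding \<mu>_def by (rule cSup_upper[OF _ bdd])
    then have "(1 / sqrt N)\<^sup>2 * quad_form K S f \<le> \<mu>"
      unfolding quad_form_scale .
    then show ?thesis
      using N by (simp add: power_divide pos_divide_le_eq N_def)
  qed
  have \<mu>: "0 < \<mu>"
  proof (rule ccontr)
    assume "\<not> 0 < \<mu>"
    then have "\<mu> * (\<Sum>x\<in>S0. (f0 x)\<^sup>2) \<le> 0"
      by (intro mult_nonpos_nonneg sum_nonneg) auto
    then show False
      using ub[OF pos(1), of f0] pos(2) by linarith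
  qed
  have V_ne: "V \<noteq> {}"
  proof
    assume "V = {}"
    have "(\<Sum>x\<in>{undefined::'a}. (1::real)\<^sup>2) = 1"
      by simp
    then have "quad_form K {undefined} (\<lambda>_. 1) \<in> V"
      unfolding V_def by blast
    then show False
      using \<open>V = {}\<close> by simp
  qed
  have "\<exists>S f. finite S \<and> (\<Sum>x\<in>S. (f x)\<^sup>2) = 1 \<and> (\<forall>x. x \<notin> S \<longrightarrow> f x = 0)
      \<and> \<mu> - 1 / (real n + 1) < quad_form K S f" for n
  proof -
    have "\<mu> - 1 / (real n + 1) < Sup V"
      by (simp add: \<mu>_def)
    then obtain S f where S: "finite S" "(\<Sum>x\<in>S. (f x)\<^sup>2) = 1" "\<mu> - 1 / (real n + 1) < quad_form K S f"
      using less_cSup_iff[OF V_ne bdd] by (auto simp: V_def)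
    let ?f = "\<lambda>x. if x \<in> S then f x else 0"
    have "quad_form K S ?f = quad_form K S f" "(\<Sum>x\<in>S. (?f x)\<^sup>2) = 1"
      using S(2) by (simp_all add: quad_form_def)
    then show ?thesis
      using S by (intro exI[of _ S] exI[of _ ?f]) auto
  qed
  then obtain S f where S: "\<And>n. finite (S n)" and norm: "\<And>n. (\<Sum>x\<in>S n. (f n x)\<^sup>2) = 1"
    and supp: "\<And>n x. x \<notin> S n \<Longrightarrow> f n x = (0::real)"
    and max: "\<And>n. \<mu> - 1 / (real n + 1) < quad_form K (S n) (f n)"
    by metis
  have norm_le: "(\<Sum>x\<in>F. (f n x)\<^sup>2) \<le> 1" if "finite F" for F n
  proof -
    have "(\<Sum>x\<in>F. (f n x)\<^sup>2) \<le> (\<Sum>x\<in>F \<union> S n. (f n x)\<^sup>2)"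
      using that S by (intro sum_mono2) auto
    also have "\<dots> = (\<Sum>x\<in>S n. (f n x)\<^sup>2)"
      using that S supp by (intro sum.mono_neutral_right) auto
    finally show ?thesis
      using norm by simp
  qed
  have f_le: "\<bar>f n x\<bar> \<le> 1" for n x
    using norm_le[of "{x}" n] by (simp add: abs_square_le_1)
  obtain r u where r: "strict_mono r" and u: "\<And>x. (\<lambda>n. f (r n) x) \<longlonglongrightarrow> u x"
    using bounded_pointwise_subsequence[of f] f_le by metis
  define s where "s n w = (\<Sum>y\<in>insert w (S n). K w y * f n y)" for n w
  have s_sum: "((\<lambda>y. K w y * f n y) has_sum s n w) UNIV" for n w
    unfolding s_def using S supp by (intro has_sum_finite_support) auto
  \<comment> \<open>The form \<open>\<mu> - K\<close> is positive semidefinite and at most \<open>1 / (n + 1)\<close> at \<open>f n\<close>; pair it with point masses.\<close>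
  have small: "(\<mu> * f n w - s n w)\<^sup>2 \<le> (\<mu> - K w w + 1) * (1 / (real n + 1))" for n w
  proof -
    define L where "L x y = \<mu> * of_bool (x = y) - K x y" for x y
    have quad_L: "quad_form L T g = \<mu> * (\<Sum>x\<in>T. (g x)\<^sup>2) - quad_form K T g" if "finite T" for T g
    proof -
      have "quad_form L T g = (\<Sum>x\<in>T. \<Sum>y\<in>T. (if x = y then \<mu> * (g x)\<^sup>2 else 0) - K x y * g x * g y)"
        unfolding quad_form_def L_def
        by (intro sum.cong refl) (auto simp: algebra_simps power2_eq_square)
      then show ?thesis
        using that by (simp add: sum_subtractf quad_form_def sum_distrib_left)
    qed
    let ?T = "insert w (S n)"
    have T: "finite ?T" "w \<in> ?T"
      using S by auto
    have psd: "0 \<le> quad_form L ?T g" for g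
      using quad_L[OF T(1)] ub[OF T(1), of g] by simp
    have L_sym: "L x y = L y x" for x y
      using sym[of x y] by (auto simp: L_def)
    have "(\<Sum>y\<in>?T. L w y * f n y) = (\<Sum>y\<in>?T. (if y = w then \<mu> * f n y else 0) - K w y * f n y)"
      by (intro sum.cong refl) (auto simp: L_def algebra_simps)
    also have "\<dots> = (\<Sum>y\<in>?T. if y = w then \<mu> * f n y else 0) - s n w"
      unfolding s_def by (rule sum_subtractf)
    also have "(\<Sum>y\<in>?T. if y = w then \<mu> * f n y else 0) = \<mu> * f n w"
      using T by (subst sum.delta) auto
    finally have "(\<mu> * f n w - s n w)\<^sup>2 \<le> (L w w + 1) * quad_form L ?T (f n)"
      using quad_form_Cauchy_Schwarz[OF T L_sym psd, of "f n"] by simp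
    also have "\<dots> \<le> (L w w + 1) * (1 / (real n + 1))"
    proof (rule mult_left_mono)
      have "\<mu> * (\<Sum>x\<in>?T. (f n x)\<^sup>2) \<le> \<mu> * 1"
        using \<mu> by (intro mult_left_mono norm_le[OF T(1)]) auto
      moreover have "quad_form K ?T (f n) = quad_form K (S n) (f n)"
        using T(1) supp by (intro quad_form_mono_neutral) auto
      ultimately show "quad_form L ?T (f n) \<le> 1 / (real n + 1)"
        using max[of n] quad_L[OF T(1), of "f n"] by linarith
      show "0 \<le> L w w + 1"
        using ub[of "{w}" "\<lambda>_. 1"] by (simp add: L_def quad_form_def)
    qed
    finally show ?thesis
      by (simp add: L_def)
  qed
  have eig: "((\<lambda>y. K w y * u y) has_sum (\<mu> * u w)) UNIV" for w
  proof (rule has_sum_dominated_tendsto[OF summ, where g = "\<lambda>n. f (r n)" and s = "\<lambda>n. s (r n) w"])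
    have bound_lim: "(\<lambda>n. (\<mu> - K w w + 1) * (1 / (real n + 1))) \<longlonglongrightarrow> 0"
      by (rule tendsto_mult_right_zero[OF inverse_Suc_tendsto_0])
    have "(\<lambda>n. (\<mu> * f n w - s n w)\<^sup>2) \<longlonglongrightarrow> 0"
      by (rule tendsto_sandwich[OF _ _ tendsto_const bound_lim]) (use small in auto)
    then have "(\<lambda>n. \<mu> * f n w - s n w) \<longlonglongrightarrow> 0"
      by simp
    then have "(\<lambda>n. \<mu> * f (r n) w - s (r n) w) \<longlonglongrightarrow> 0"
      using LIMSEQ_subseq_LIMSEQ[OF _ r] by (fastforce simp: o_def)
    then have "(\<lambda>n. \<mu> * f (r n) w - (\<mu> * f (r n) w - s (r n) w)) \<longlonglongrightarrow> \<mu> * u w - 0"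
      by (intro tendsto_intros u)
    then show "(\<lambda>n. s (r n) w) \<longlonglongrightarrow> \<mu> * u w"
      by simp
  qed (use f_le u s_sum in auto)
  have "(\<lambda>x. (u x)\<^sup>2) summable_on UNIV"
  proof (rule nonneg_bdd_above_summable_on)
    show "bdd_above (sum (\<lambda>x. (u x)\<^sup>2) ` {F. F \<subseteq> UNIV \<and> finite F})"
    proof (rule bdd_aboveI2)
      fix F :: "'a set" assume "F \<in> {F. F \<subseteq> UNIV \<and> finite F}"
      then have "\<And>n. (\<Sum>x\<in>F. (f (r n) x)\<^sup>2) \<le> 1"
        using norm_le by simp
      moreover have "(\<lambda>n. \<Sum>x\<in>F. (f (r n) x)\<^sup>2) \<longlonglongrightarrow> (\<Sum>x\<in>F. (u x)\<^sup>2)"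
        by (intro tendsto_intros u)
      ultimately show "(\<Sum>x\<in>F. (u x)\<^sup>2) \<le> 1"
        using LIMSEQ_le_const2 by blast
    qed
  qed auto
  \<comment> \<open>Some mass stays: outside the finite set \<open>{\<mu> / 4 \<le> B}\<close> the potential contributes at most \<open>\<mu> / 4\<close>.\<close>
  moreover have "\<exists>x. u x \<noteq> 0"
  proof (rule ccontr)
    assume "\<nexists>x. u x \<noteq> 0"
    then have u0: "u x = 0" for x
      by simp
    define F where "F = {x. \<mu> / 4 \<le> B x}"
    have F: "finite F"
      unfolding F_def by (rule B_fin) (use \<mu> in simp)
    have "\<mu> - 1 / (real n + 1) - \<mu> / 4 \<le> (\<Sum>x\<in>F. B x * (f n x)\<^sup>2)" for n
    proof -
      have "quad_form K (S n) (f n) \<le> (\<Sum>x\<in>S n. B x * (f n x)\<^sup>2)"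
        by (rule upper[OF S])
      also have "\<dots> \<le> (\<Sum>x\<in>S n. (if x \<in> F then B x * (f n x)\<^sup>2 else 0) + \<mu> / 4 * (f n x)\<^sup>2)"
      proof (rule sum_mono)
        fix x
        show "B x * (f n x)\<^sup>2 \<le> (if x \<in> F then B x * (f n x)\<^sup>2 else 0) + \<mu> / 4 * (f n x)\<^sup>2"
        proof (cases "x \<in> F")
          case True
          then show ?thesis
            using \<mu> by simp
        next
          case False
          then have "B x * (f n x)\<^sup>2 \<le> \<mu> / 4 * (f n x)\<^sup>2"
            by (intro mult_right_mono) (auto simp: F_def)
          then show ?thesis
            using False by simp
        qed
      qed
      also have "\<dots> = (\<Sum>x\<in>S n. if x \<in> F then B x * (f n x)\<^sup>2 else 0) + \<mu> / 4"
        by (simp only: sum.distrib sum_distrib_left[symmetric] norm mult_1_right)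
      also have "(\<Sum>x\<in>S n. if x \<in> F then B x * (f n x)\<^sup>2 else 0) = (\<Sum>x\<in>S n \<inter> F. B x * (f n x)\<^sup>2)"
        using S by (simp add: sum.inter_restrict)
      also have "\<dots> \<le> (\<Sum>x\<in>F. B x * (f n x)\<^sup>2)"
        using F B_nonneg by (intro sum_mono2) auto
      finally show ?thesis
        using max[of n] by linarith
    qed
    moreover have "(\<lambda>n. \<Sum>x\<in>F. B x * (f (r n) x)\<^sup>2) \<longlonglongrightarrow> (\<Sum>x\<in>F. B x * (u x)\<^sup>2)"
      by (intro tendsto_intros u)
    moreover have "(\<lambda>n. \<mu> - 1 / (real (r n) + 1) - \<mu> / 4) \<longlonglongrightarrow> \<mu> - 0 - \<mu> / 4"
    proof -
      from LIMSEQ_subseq_LIMSEQ[OF inverse_Suc_tendsto_0 r] show ?thesis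
        by (intro tendsto_intros) (simp add: o_def)
    qed
    ultimately have "\<mu> - 0 - \<mu> / 4 \<le> (\<Sum>x\<in>F. B x * (u x)\<^sup>2)"
      by (intro LIMSEQ_le) auto
    then show False
      using \<mu> u0 by simp
  qed
  ultimately show ?thesis
    using \<mu> eig by blast
qed

text \<open>The converse. Restricting an eigenvector to \<open>S\<close> changes the form by the interaction of \<open>S\<close> with its
complement, which bounded row sums control by the mass of the eigenvector outside \<open>S\<close>.\<close>

lemma truncated_eigenvector_positive:
  fixes K :: "'a \<Rightarrow> 'a \<Rightarrow> real"
  assumes sym: "\<And>x y. K x y = K y x"
    and rows: "\<And>x F. finite F \<Longrightarrow> (\<Sum>y\<in>F. \<bar>K x y\<bar>) \<le> C" and C: "0 < C"
    and u: "(\<lambda>x. (u x)\<^sup>2) summable_on UNIV" "\<exists>x. u x \<noteq> 0"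
    and \<mu>: "0 < \<mu>" and eig: "\<And>x. ((\<lambda>y. K x y * u y) has_sum (\<mu> * u x)) UNIV"
  obtains S where "finite S" "0 < quad_form K S u"
proof -
  define N where "N = infsum (\<lambda>x. (u x)\<^sup>2) UNIV"
  have N_has_sum: "((\<lambda>x. (u x)\<^sup>2) has_sum N) UNIV"
    unfolding N_def using u(1) by simp
  obtain x0 where "u x0 \<noteq> 0"
    using u(2) by blast
  moreover have "(\<Sum>x\<in>{x0}. (u x)\<^sup>2) \<le> N"
    using N_has_sum by (rule finite_sum_le_has_sum) auto
  ultimately have N: "0 < N"
    by (smt (verit) sum.empty sum.insert finite.emptyI empty_iff zero_less_power2)
  \<comment> \<open>With \<open>\<tau> \<le> \<eta>\<close> the mass outside \<open>S\<close>, the losses \<open>\<mu> \<tau>\<close>, \<open>C \<epsilon> (N - \<tau>) / 2\<close> and \<open>C \<tau> / (2 \<epsilon>)\<close> below are at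
    most \<open>\<mu> N / 8\<close>, \<open>\<mu> N / 4\<close> and \<open>\<mu> N / 4\<close>.\<close>
  define \<eta> where "\<eta> = min (N / 8) (\<mu>\<^sup>2 * N / (4 * C\<^sup>2))"
  have \<eta>: "0 < \<eta>"
    using N \<mu> C by (simp add: \<eta>_def)
  obtain S where S: "finite S" "dist (\<Sum>x\<in>S. (u x)\<^sup>2) N \<le> \<eta>"
    using infsum_finite_approximation[OF u(1) \<eta>] by (auto simp: N_def)
  define \<epsilon> where "\<epsilon> = \<mu> / (2 * C)"
  have \<epsilon>: "0 < \<epsilon>"
    using \<mu> C by (simp add: \<epsilon>_def)
  define \<tau> where "\<tau> = N - (\<Sum>x\<in>S. (u x)\<^sup>2)"
  have \<tau>_has_sum: "((\<lambda>x. (u x)\<^sup>2) has_sum \<tau>) (UNIV - S)"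
    unfolding \<tau>_def by (rule has_sum_Diff[OF N_has_sum has_sum_finite[OF S(1)]]) auto
  have \<tau>_nonneg: "0 \<le> \<tau>"
    using \<tau>_has_sum by (rule has_sum_nonneg) auto
  have \<tau>_le: "\<tau> \<le> \<eta>"
    using S(2) by (simp add: \<tau>_def dist_real_def)
  define r where "r x = infsum (\<lambda>y. \<bar>K x y\<bar>) (UNIV - S)" for x
  have row_summable: "(\<lambda>y. \<bar>K x y\<bar>) summable_on A" for x A
    by (rule nonneg_bdd_above_summable_on) (auto intro!: bdd_aboveI2[where M = C] rows)
  have r_has_sum: "((\<lambda>y. \<bar>K x y\<bar>) has_sum r x) (UNIV - S)" for x
    unfolding r_def using row_summable by simp
  have r_le: "r x \<le> C" for x
    unfolding r_def by (rule infsum_le_finite_sums[OF row_summable]) (auto intro: rows)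
  have outer: "((\<lambda>y. \<Sum>x\<in>S. u x * (K x y * u y)) has_sum
      (\<Sum>x\<in>S. u x * (\<mu> * u x - (\<Sum>y\<in>S. K x y * u y)))) (UNIV - S)"
    by (intro has_sum_sum has_sum_cmult_right has_sum_Diff eig has_sum_finite S(1)) auto
  have outer_bound: "((\<lambda>y. (\<Sum>x\<in>S. \<epsilon> / 2 * (u x)\<^sup>2 * \<bar>K x y\<bar>) + C / (2 * \<epsilon>) * (u y)\<^sup>2) has_sum
      (\<Sum>x\<in>S. \<epsilon> / 2 * (u x)\<^sup>2 * r x) + C / (2 * \<epsilon>) * \<tau>) (UNIV - S)"
    by (intro has_sum_add has_sum_sum has_sum_cmult_right r_has_sum \<tau>_has_sum)
  have young: "\<bar>p * q\<bar> \<le> \<epsilon> / 2 * p\<^sup>2 + 1 / (2 * \<epsilon>) * q\<^sup>2" for p q :: real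
  proof -
    have "0 \<le> (\<epsilon> * \<bar>p\<bar> - \<bar>q\<bar>)\<^sup>2 / (2 * \<epsilon>)"
      using \<epsilon> by simp
    also have "\<dots> = \<epsilon> / 2 * p\<^sup>2 + 1 / (2 * \<epsilon>) * q\<^sup>2 - \<bar>p * q\<bar>"
      using \<epsilon> by (simp add: field_simps power2_eq_square abs_mult)
    finally show ?thesis
      by simp
  qed
  have "norm (\<Sum>x\<in>S. u x * (\<mu> * u x - (\<Sum>y\<in>S. K x y * u y)))
      \<le> (\<Sum>x\<in>S. \<epsilon> / 2 * (u x)\<^sup>2 * r x) + C / (2 * \<epsilon>) * \<tau>"
  proof (rule norm_infsum_le[OF outer outer_bound])
    fix y
    have "norm (\<Sum>x\<in>S. u x * (K x y * u y)) \<le> (\<Sum>x\<in>S. \<bar>K x y\<bar> * \<bar>u x * u y\<bar>)"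
      by (rule order_trans[OF norm_sum]) (simp add: abs_mult mult_ac)
    also have "\<dots> \<le> (\<Sum>x\<in>S. \<bar>K x y\<bar> * (\<epsilon> / 2 * (u x)\<^sup>2 + 1 / (2 * \<epsilon>) * (u y)\<^sup>2))"
      by (intro sum_mono mult_left_mono young) auto
    also have "\<dots> = (\<Sum>x\<in>S. \<epsilon> / 2 * (u x)\<^sup>2 * \<bar>K x y\<bar>) + (\<Sum>x\<in>S. \<bar>K y x\<bar>) * (1 / (2 * \<epsilon>) * (u y)\<^sup>2)"
      unfolding sum_distrib_right sum.distrib[symmetric]
      by (intro sum.cong refl) (simp add: sym[of y] algebra_simps)
    also have "\<dots> \<le> (\<Sum>x\<in>S. \<epsilon> / 2 * (u x)\<^sup>2 * \<bar>K x y\<bar>) + C * (1 / (2 * \<epsilon>) * (u y)\<^sup>2)"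
      using \<epsilon> by (intro add_left_mono mult_right_mono rows S) auto
    finally show "norm (\<Sum>x\<in>S. u x * (K x y * u y))
        \<le> (\<Sum>x\<in>S. \<epsilon> / 2 * (u x)\<^sup>2 * \<bar>K x y\<bar>) + C / (2 * \<epsilon>) * (u y)\<^sup>2"
      by simp
  qed
  moreover have "(\<Sum>x\<in>S. u x * (\<mu> * u x - (\<Sum>y\<in>S. K x y * u y))) = \<mu> * (N - \<tau>) - quad_form K S u"
    unfolding \<tau>_def quad_form_def
    by (simp add: sum_distrib_left sum_subtractf right_diff_distrib power2_eq_square mult_ac)
  moreover have "(\<Sum>x\<in>S. \<epsilon> / 2 * (u x)\<^sup>2 * r x) \<le> (\<Sum>x\<in>S. \<epsilon> / 2 * (u x)\<^sup>2 * C)"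
    using \<epsilon> by (intro sum_mono mult_left_mono r_le) auto
  moreover have "(\<Sum>x\<in>S. \<epsilon> / 2 * (u x)\<^sup>2 * C) = \<mu> / 4 * (N - \<tau>)"
    using C by (simp add: \<epsilon>_def \<tau>_def sum_distrib_left)
  moreover have "C / (2 * \<epsilon>) * \<tau> \<le> \<mu> * N / 4"
  proof -
    have "C / (2 * \<epsilon>) * \<tau> \<le> C / (2 * \<epsilon>) * (\<mu>\<^sup>2 * N / (4 * C\<^sup>2))"
      using \<tau>_le C \<epsilon> by (intro mult_left_mono) (auto simp: \<eta>_def)
    also have "\<dots> = \<mu> * N / 4"
      using C \<mu> by (simp add: \<epsilon>_def power2_eq_square)
    finally show ?thesis .
  qed
  moreover have "\<mu> * \<tau> \<le> \<mu> * (N / 8)"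
    using \<tau>_le \<mu> by (intro mult_left_mono) (auto simp: \<eta>_def)
  moreover have "0 < \<mu> * N"
    using \<mu> N by simp
  ultimately have "0 < quad_form K S u"
    by (simp add: algebra_simps abs_le_iff)
  then show thesis
    using that S(1) by blast
qed

section \<open>Eigenvalue counting and square-summable functions\<close>

lemma num_pos_eigenvalues_ge_1:
  assumes "0 < \<mu>" "eigenvalue T \<mu>"
  shows "1 \<le> num_pos_eigenvalues T"
proof -
  obtain f where f: "f \<in> eigenspace T \<mu>" "f \<noteq> 0"
    using assms(2) by (auto simp: eigenvalue_def)
  then have "{f} \<in> {S. finite S \<and> S \<subseteq> eigenspace T \<mu> \<and> cfun.independent S}"
    by (simp add: cfun.dependent_single)
  then have "enat (card {f}) \<le> eigen_multiplicity T \<mu>"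
    unfolding eigen_multiplicity_def by (rule SUP_upper)
  then have "1 \<le> eigen_multiplicity T \<mu>"
    by (simp add: one_enat_def)
  also have "eigen_multiplicity T \<mu> = infsum (eigen_multiplicity T) {\<mu>}"
    by simp
  also have "\<dots> \<le> num_pos_eigenvalues T"
    unfolding num_pos_eigenvalues_def
    by (rule infsum_mono_neutral) (use assms in \<open>auto intro: nonneg_summable_on_complete\<close>)
  finally show ?thesis .
qed

lemma num_pos_eigenvalues_eq_0:
  assumes "\<And>\<mu>. 0 < \<mu> \<Longrightarrow> \<not> eigenvalue T \<mu>"
  shows "num_pos_eigenvalues T = 0"
proof -
  have "{\<mu>. 0 < \<mu> \<and> eigenvalue T \<mu>} = {}"
    using assms by auto
  then show ?thesis
    unfolding num_pos_eigenvalues_def by (simp only: infsum_empty)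
qed

lemma l2_bounded:
  assumes "f \<in> l2"
  obtains M where "\<And>x. cmod (f x) \<le> M"
proof -
  have "cmod (f x) \<le> sqrt (infsum (\<lambda>x. (cmod (f x))\<^sup>2) UNIV)" for x
    using finite_sum_le_infsum[of "\<lambda>x. (cmod (f x))\<^sup>2" UNIV "{x}"] assms
    by (intro real_le_rsqrt) (auto simp: l2_def)
  then show thesis
    using that by blast
qed

section \<open>The Dirichlet form and transience\<close>

lemma has_sum_translate:
  fixes x :: "'g::ab_group_add"
  shows "((\<lambda>y. f (y - x)) has_sum s) UNIV \<longleftrightarrow> (f has_sum s) UNIV"
  by (rule has_sum_reindex_bij_betw) (rule bij_betw_byWitness[where f' = "\<lambda>z. z + x"], auto)

text \<open>The Dirichlet form \<open>-\<langle>\<A>f, f\<rangle>\<close> of the walk with jump kernel \<open>a\<close> of total mass one, at a function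
supported in \<open>S\<close>. In this form it is a finite sum although the jump kernel may have infinite support.\<close>

definition dirichlet_form ::
  "('g::ab_group_add \<Rightarrow> real) \<Rightarrow> 'g set \<Rightarrow> ('g \<Rightarrow> real) \<Rightarrow> real" where
  "dirichlet_form a S f = (\<Sum>x\<in>S. (f x)\<^sup>2) - quad_form (\<lambda>x y. a (y - x)) S f"

lemma sum_square_increments:
  fixes f :: "'g::ab_group_add \<Rightarrow> real"
  assumes S: "finite S" and supp: "\<And>x. x \<notin> S \<Longrightarrow> f x = 0"
    and T: "finite T" "S \<subseteq> T" "(\<lambda>x. x - z) ` S \<subseteq> T"
  shows "(\<Sum>x\<in>T. (f x - f (x + z))\<^sup>2) = 2 * ((\<Sum>x\<in>S. (f x)\<^sup>2) - (\<Sum>x\<in>S. f x * f (x + z)))"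
proof -
  have "(\<Sum>x\<in>T. (f (x + z))\<^sup>2) = (\<Sum>x\<in>(\<lambda>x. x - z) ` S. (f (x + z))\<^sup>2)"
  proof (rule sum.mono_neutral_right[OF T(1,3)], intro ballI)
    fix x assume "x \<in> T - (\<lambda>x. x - z) ` S"
    then have "x + z \<notin> S"
      by (metis DiffD2 add_diff_cancel image_eqI)
    then show "(f (x + z))\<^sup>2 = 0"
      using supp by simp
  qed
  also have "\<dots> = (\<Sum>x\<in>S. (f x)\<^sup>2)"
    by (subst sum.reindex) (auto simp: inj_on_def)
  finally have shifted: "(\<Sum>x\<in>T. (f (x + z))\<^sup>2) = (\<Sum>x\<in>S. (f x)\<^sup>2)" .
  have "(\<Sum>x\<in>T. (f x)\<^sup>2) = (\<Sum>x\<in>S. (f x)\<^sup>2)"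
    using T supp by (intro sum.mono_neutral_right) auto
  moreover have "(\<Sum>x\<in>T. f x * f (x + z)) = (\<Sum>x\<in>S. f x * f (x + z))"
    using T supp by (intro sum.mono_neutral_right) auto
  ultimately show ?thesis
    using shifted by (simp add: power2_diff sum_subtractf sum.distrib sum_distrib_left[symmetric] mult.assoc)
qed

text \<open>Decomposition of the Dirichlet form according to the jump \<open>z\<close>. By \<open>sum_square_increments\<close>, each term
is \<open>a z / 2\<close> times a sum of squared increments of \<open>f\<close>.\<close>

lemma dirichlet_form_has_sum:
  fixes a f :: "'g::ab_group_add \<Rightarrow> real"
  assumes a: "(a has_sum 1) UNIV" and S: "finite S" and supp: "\<And>x. x \<notin> S \<Longrightarrow> f x = 0"
  shows "((\<lambda>z. a z * ((\<Sum>x\<in>S. (f x)\<^sup>2) - (\<Sum>x\<in>S. f x * f (x + z)))) has_sum dirichlet_form a S f) UNIV"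
proof -
  have "((\<lambda>z. a z * f x * f (x + z)) has_sum (\<Sum>y\<in>S. a (y - x) * f x * f y)) UNIV" for x
  proof -
    have "((\<lambda>y. a (y - x) * f x * f y) has_sum (\<Sum>y\<in>S. a (y - x) * f x * f y)) UNIV"
      using S supp by (intro has_sum_finite_support) auto
    then show ?thesis
      using has_sum_translate[of "\<lambda>z. a z * f x * f (x + z)" x] by simp
  qed
  then have "((\<lambda>z. a z * (\<Sum>x\<in>S. (f x)\<^sup>2) + - (\<Sum>x\<in>S. a z * f x * f (x + z))) has_sum
      1 * (\<Sum>x\<in>S. (f x)\<^sup>2) + - (\<Sum>x\<in>S. \<Sum>y\<in>S. a (y - x) * f x * f y)) UNIV"
    by (intro has_sum_add has_sum_uminusI has_sum_cmult_left a has_sum_sum)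
  then show ?thesis
    by (simp add: dirichlet_form_def quad_form_def right_diff_distrib sum_distrib_left mult.assoc)
qed

lemma square_increments_le_dirichlet_form:
  fixes a f :: "'g::ab_group_add \<Rightarrow> real"
  assumes a: "(a has_sum 1) UNIV" "\<And>z. 0 \<le> a z"
    and S: "finite S" "\<And>x. x \<notin> S \<Longrightarrow> f x = 0" and T: "finite T"
  shows "a z * (\<Sum>x\<in>T. (f x - f (x + z))\<^sup>2) \<le> 2 * dirichlet_form a S f"
proof -
  have increments: "0 \<le> (\<Sum>x\<in>S. (f x)\<^sup>2) - (\<Sum>x\<in>S. f x * f (x + w))" for w
  proof -
    have "0 \<le> (\<Sum>x\<in>S \<union> (\<lambda>x. x - w) ` S. (f x - f (x + w))\<^sup>2)"
      by (intro sum_nonneg) auto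
    then show ?thesis
      using sum_square_increments[of S f "S \<union> (\<lambda>x. x - w) ` S" w] S by simp
  qed
  let ?T = "T \<union> (S \<union> (\<lambda>x. x - z) ` S)"
  have "(\<Sum>x\<in>T. (f x - f (x + z))\<^sup>2) \<le> (\<Sum>x\<in>?T. (f x - f (x + z))\<^sup>2)"
    using S(1) T by (intro sum_mono2) auto
  also have "\<dots> = 2 * ((\<Sum>x\<in>S. (f x)\<^sup>2) - (\<Sum>x\<in>S. f x * f (x + z)))"
    using S(1) T by (intro sum_square_increments S) auto
  finally have "a z * (\<Sum>x\<in>T. (f x - f (x + z))\<^sup>2)
      \<le> a z * (2 * ((\<Sum>x\<in>S. (f x)\<^sup>2) - (\<Sum>x\<in>S. f x * f (x + z))))"
    by (intro mult_left_mono a)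
  moreover have "(\<Sum>z\<in>{z}. a z * ((\<Sum>x\<in>S. (f x)\<^sup>2) - (\<Sum>x\<in>S. f x * f (x + z)))) \<le> dirichlet_form a S f"
    by (rule finite_sum_le_has_sum[OF dirichlet_form_has_sum[OF a(1) S]])
      (auto intro!: mult_nonneg_nonneg a increments)
  ultimately show ?thesis
    by (simp add: algebra_simps)
qed

lemma dirichlet_form_nonneg:
  fixes a f :: "'g::ab_group_add \<Rightarrow> real"
  assumes "(a has_sum 1) UNIV" "\<And>z. 0 \<le> a z" "finite S"
  shows "0 \<le> dirichlet_form a S f"
proof -
  let ?f = "\<lambda>x. if x \<in> S then f x else 0"
  have "0 \<le> dirichlet_form a S ?f"
    using square_increments_le_dirichlet_form[of a S ?f "{}" 0] assms by simp
  also have "\<dots> = dirichlet_form a S f"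
    by (simp add: dirichlet_form_def quad_form_def)
  finally show ?thesis .
qed

text \<open>The octant enters as an injective map \<open>p\<close> that turns unit steps into jumps of positive rate.\<close>

lemma transience:
  fixes a f :: "'g::ab_group_add \<Rightarrow> real"
  assumes a: "(a has_sum 1) UNIV" "\<And>z. 0 \<le> a z"
    and S: "finite S" "\<And>x. x \<notin> S \<Longrightarrow> f x = 0"
    and p: "inj (\<lambda>(i, j, k). p i j k)"
      "\<And>i j k. p (Suc i) j k = p i j k + e\<^sub>1"
      "\<And>i j k. p i (Suc j) k = p i j k + e\<^sub>2"
      "\<And>i j k. p i j (Suc k) = p i j k + e\<^sub>3"
    and e: "0 < a e\<^sub>1" "0 < a e\<^sub>2" "0 < a e\<^sub>3"
  shows "(f (p 0 0 0))\<^sup>2 \<le> 24 * (1 / a e\<^sub>1 + 1 / a e\<^sub>2 + 1 / a e\<^sub>3) * dirichlet_form a S f"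
proof -
  define P where "P = (\<lambda>(i, j, k). p i j k) -` S"
  have P: "finite P"
    unfolding P_def using S(1) p(1) by (rule finite_vimageI)
  \<comment> \<open>Any bound on the coordinates of the preimage of \<open>S\<close> suffices.\<close>
  define N where "N = Suc (\<Sum>(i, j, k)\<in>P. i + j + k)"
  have vanish: "f (p i j k) = 0" if "N \<le> i \<or> N \<le> j \<or> N \<le> k" for i j k
  proof (rule S(2), rule notI)
    assume "p i j k \<in> S"
    then have "(i, j, k) \<in> P"
      by (simp add: P_def)
    from member_le_sum[OF this _ P, of "\<lambda>(i, j, k). i + j + k"] show False
      using that by (auto simp: N_def)
  qed
  have grad: "(\<Sum>i<N. \<Sum>j<N. \<Sum>k<N. (f (p i j k) - f (p i j k + w))\<^sup>2)
      \<le> 2 / a w * dirichlet_form a S f" if "0 < a w" for w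
  proof -
    let ?T = "{..<N} \<times> {..<N} \<times> {..<N}"
    have "(\<Sum>i<N. \<Sum>j<N. \<Sum>k<N. (f (p i j k) - f (p i j k + w))\<^sup>2)
        = (\<Sum>q\<in>?T. (\<lambda>y. (f y - f (y + w))\<^sup>2) ((\<lambda>(i, j, k). p i j k) q))"
      by (simp add: sum.cartesian_product case_prod_unfold)
    also have "\<dots> = (\<Sum>y\<in>(\<lambda>(i, j, k). p i j k) ` ?T. (f y - f (y + w))\<^sup>2)"
      using p(1) by (simp add: sum.reindex inj_on_subset[of _ UNIV])
    finally have "a w * (\<Sum>i<N. \<Sum>j<N. \<Sum>k<N. (f (p i j k) - f (p i j k + w))\<^sup>2)
        \<le> 2 * dirichlet_form a S f"
      using square_increments_le_dirichlet_form[of a S f "(\<lambda>(i, j, k). p i j k) ` ?T" w] a S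
      by simp
    then show ?thesis
      using that by (simp add: pos_le_divide_eq mult.commute)
  qed
  have "(f (p 0 0 0))\<^sup>2 \<le> 12 *
    ((\<Sum>i<N. \<Sum>j<N. \<Sum>k<N. (f (p i j k) - f (p i j k + e\<^sub>1))\<^sup>2)
     + (\<Sum>i<N. \<Sum>j<N. \<Sum>k<N. (f (p i j k) - f (p i j k + e\<^sub>2))\<^sup>2)
     + (\<Sum>i<N. \<Sum>j<N. \<Sum>k<N. (f (p i j k) - f (p i j k + e\<^sub>3))\<^sup>2))"
    using octant_transience[of N "\<lambda>i j k. f (p i j k)"] vanish unfolding p(2-4) by blast
  also have "\<dots> \<le> 12 * (2 / a e\<^sub>1 * dirichlet_form a S f + 2 / a e\<^sub>2 * dirichlet_form a S f
      + 2 / a e\<^sub>3 * dirichlet_form a S f)"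
    by (intro mult_left_mono add_mono grad e) auto
  also have "\<dots> = 24 * (1 / a e\<^sub>1 + 1 / a e\<^sub>2 + 1 / a e\<^sub>3) * dirichlet_form a S f"
    by (simp add: algebra_simps)
  finally show ?thesis .
qed

lemma lattice_norm_axis: "lattice_norm (axis i 1) = 1"
proof -
  have "(\<chi> j. real_of_int (axis i 1 $ j)) = axis i (1::real)"
    by (auto simp: vec_eq_iff axis_def)
  then show ?thesis
    by (simp add: lattice_norm_def)
qed

lemma lattice_transience:
  fixes a :: "int ^ 'd::finite \<Rightarrow> real"
  assumes a: "(a has_sum 1) UNIV" "\<And>z. 0 \<le> a z" "\<And>z. lattice_norm z = 1 \<Longrightarrow> 0 < a z"
    and dim: "3 \<le> CARD('d)"
  obtains C where "0 < C" "\<And>S f x. finite S \<Longrightarrow> (\<And>x. x \<notin> S \<Longrightarrow> f x = 0) \<Longrightarrow>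
    (f x)\<^sup>2 \<le> C * dirichlet_form a S f"
proof -
  obtain A :: "'d set" where "card A = 3"
    using obtain_subset_with_card_n[OF dim] by metis
  then obtain l m n :: 'd where lmn: "l \<noteq> m" "l \<noteq> n" "m \<noteq> n"
    by (auto simp: card_3_iff)
  define v :: "nat \<Rightarrow> nat \<Rightarrow> nat \<Rightarrow> int ^ 'd" where
    "v i j k = axis l (int i) + axis m (int j) + axis n (int k)" for i j k
  have v_l: "v i j k $ l = int i" and v_m: "v i j k $ m = int j" and v_n: "v i j k $ n = int k" for i j k
    using lmn by (auto simp: v_def axis_def)
  have Suc: "axis h (int (Suc i)) = axis h (int i) + axis h 1" for h :: 'd and i
    by (auto simp: vec_eq_iff axis_def)
  define C where "C = 24 * (1 / a (axis l 1) + 1 / a (axis m 1) + 1 / a (axis n 1))"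
  have pos: "0 < a (axis h 1)" for h
    by (intro a(3) lattice_norm_axis)
  have "0 < C"
    unfolding C_def using pos[of l] pos[of m] pos[of n] by (intro mult_pos_pos add_pos_pos) auto
  moreover have "(f x)\<^sup>2 \<le> C * dirichlet_form a S f"
    if S: "finite S" "\<And>x. x \<notin> S \<Longrightarrow> f x = 0" for S f x
  proof -
    have inj: "inj (\<lambda>(i, j, k). x + v i j k)"
    proof (rule injI)
      fix q q' :: "nat \<times> nat \<times> nat"
      obtain i j k i' j' k' where q: "q = (i, j, k)" "q' = (i', j', k')"
        by (metis prod.exhaust)
      assume "(case q of (i, j, k) \<Rightarrow> x + v i j k) = (case q' of (i, j, k) \<Rightarrow> x + v i j k)"
      then have "v i j k = v i' j' k'"
        by (simp add: q)
      then have "int i = int i' \<and> int j = int j' \<and> int k = int k'"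
        using v_l v_m v_n by metis
      then show "q = q'"
        by (simp add: q)
    qed
    have "(f (x + v 0 0 0))\<^sup>2 \<le> C * dirichlet_form a S f"
      unfolding C_def
      by (rule transience[where f = f and S = S and p = "\<lambda>i j k. x + v i j k", OF a(1,2) S inj])
        (simp_all only: v_def Suc add_ac pos not_False_eq_True)
    moreover have "v 0 0 0 = 0"
      by (auto simp: v_def vec_eq_iff axis_def)
    ultimately show ?thesis
      by simp
  qed
  ultimately show thesis
    using that by blast
qed

section \<open>The Schroedinger operator\<close>

text \<open>The matrix of \<open>\<H>\<^sub>2\<close>. Since \<open>a\<close> has total mass one, \<open>\<A>\<close> is convolution with \<open>a\<close> minus the identity.\<close>

definition schroedinger_kernel ::
  "real \<Rightarrow> ('g::ab_group_add \<Rightarrow> real) \<Rightarrow> ('g \<Rightarrow> real) \<Rightarrow> 'g \<Rightarrow> 'g \<Rightarrow> real" where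
  "schroedinger_kernel \<kappa> a B x y = 2 * \<kappa> * a (y - x) + (if x = y then B x - 2 * \<kappa> else 0)"

lemma schroedinger_kernel_sym:
  assumes "\<And>z. a z = a (- z)"
  shows "schroedinger_kernel \<kappa> a B x y = schroedinger_kernel \<kappa> a B y x"
  using assms[of "x - y"] by (auto simp: schroedinger_kernel_def)

lemma quad_form_schroedinger:
  assumes "finite S"
  shows "quad_form (schroedinger_kernel \<kappa> a B) S f
    = (\<Sum>x\<in>S. B x * (f x)\<^sup>2) - 2 * \<kappa> * dirichlet_form a S f"
proof -
  have "quad_form (schroedinger_kernel \<kappa> a B) S f
      = (\<Sum>x\<in>S. \<Sum>y\<in>S. 2 * \<kappa> * (a (y - x) * f x * f y) + (if x = y then (B x - 2 * \<kappa>) * (f x)\<^sup>2 else 0))"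
    unfolding quad_form_def schroedinger_kernel_def
    by (intro sum.cong refl) (auto simp: algebra_simps power2_eq_square)
  also have "\<dots> = 2 * \<kappa> * quad_form (\<lambda>x y. a (y - x)) S f + (\<Sum>x\<in>S. (B x - 2 * \<kappa>) * (f x)\<^sup>2)"
    using assms by (simp add: sum.distrib quad_form_def sum_distrib_left)
  finally show ?thesis
    by (simp add: dirichlet_form_def algebra_simps sum_subtractf sum_distrib_left)
qed

lemma schroedinger_kernel_row_sum_le:
  assumes a: "(a has_sum 1) UNIV" "\<And>z. 0 \<le> a z" and B: "\<And>x. \<bar>B x\<bar> \<le> M"
    and \<kappa>: "0 < \<kappa>" and F: "finite F"
  shows "(\<Sum>y\<in>F. \<bar>schroedinger_kernel \<kappa> a B x y\<bar>) \<le> 4 * \<kappa> + M"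
proof -
  have "(\<Sum>y\<in>F. \<bar>schroedinger_kernel \<kappa> a B x y\<bar>)
      \<le> (\<Sum>y\<in>F. 2 * \<kappa> * a (y - x) + (if x = y then M + 2 * \<kappa> else 0))"
  proof (rule sum_mono)
    fix y
    show "\<bar>schroedinger_kernel \<kappa> a B x y\<bar> \<le> 2 * \<kappa> * a (y - x) + (if x = y then M + 2 * \<kappa> else 0)"
    proof -
      define q where "q = 2 * \<kappa> * a (y - x)"
      have "0 \<le> q"
        using \<kappa> a(2) by (simp add: q_def)
      then show ?thesis
        using B[of x] \<kappa> unfolding schroedinger_kernel_def q_def[symmetric] by (auto simp: abs_le_iff)
    qed
  qed
  also have "\<dots> = 2 * \<kappa> * (\<Sum>y\<in>F. a (y - x)) + (if x \<in> F then M + 2 * \<kappa> else 0)"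
    using F by (simp add: sum.distrib sum_distrib_left)
  also have "\<dots> \<le> 2 * \<kappa> * 1 + (M + 2 * \<kappa>)"
  proof (intro add_mono mult_left_mono)
    show "(\<Sum>y\<in>F. a (y - x)) \<le> 1"
      by (rule finite_sum_le_has_sum[where A = UNIV])
        (use a F has_sum_translate[of a x 1] in auto)
  qed (use \<kappa> B[of x] in auto)
  finally show ?thesis
    by simp
qed

lemma H2_has_sum:
  fixes a B :: "int ^ 'd::finite \<Rightarrow> real"
  assumes a: "(a has_sum 1) UNIV" "\<And>z. 0 \<le> a z" and f: "\<And>x. cmod (f x) \<le> M"
  shows "((\<lambda>y. of_real (schroedinger_kernel \<kappa> a B x y) * f y) has_sum H2 \<kappa> a B f x) UNIV"
proof -
  let ?g = "\<lambda>z. of_real (a z) * (f (x + z) - f x)"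
  have "?g summable_on UNIV"
  proof (rule abs_summable_summable, rule summable_on_comparison_test)
    show "(\<lambda>z. a z * (2 * M)) summable_on UNIV"
      using a(1) by (intro summable_on_cmult_left has_sum_imp_summable)
    fix z
    have "cmod (f (x + z) - f x) \<le> 2 * M"
      using norm_triangle_ineq4[of "f (x + z)" "f x"] f[of "x + z"] f[of x] by linarith
    then show "cmod (?g z) \<le> a z * (2 * M)"
      using a(2)[of z] by (simp add: norm_mult mult_left_mono)
  qed auto
  moreover have "infsum ?g UNIV = generator a f x"
    unfolding generator_def by (rule infsum_cong_neutral) auto
  ultimately have "(?g has_sum generator a f x) UNIV"
    by (metis has_sum_infsum)
  moreover have "((\<lambda>z. of_real (a z) * f x) has_sum (of_real 1 * f x)) UNIV"
    by (intro has_sum_cmult_left has_sum_of_real a)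
  ultimately have "((\<lambda>z. ?g z + of_real (a z) * f x) has_sum (generator a f x + of_real 1 * f x)) UNIV"
    by (rule has_sum_add)
  then have "((\<lambda>z. of_real (a z) * f (x + z)) has_sum (generator a f x + f x)) UNIV"
    by (simp add: algebra_simps)
  then have hop: "((\<lambda>y. of_real (a (y - x)) * f y) has_sum (generator a f x + f x)) UNIV"
    using has_sum_translate[of "\<lambda>z. of_real (a z) * f (x + z)" x] by simp
  have "((\<lambda>y. if x = y then of_real (B x - 2 * \<kappa>) * f y else 0) has_sum
      of_real (B x - 2 * \<kappa>) * f x) UNIV"
    by (rule has_sum_finite_neutralI[of "{x}"]) auto
  from has_sum_add[OF has_sum_cmult_right[OF hop, of "of_real (2 * \<kappa>)"] this]
  have "((\<lambda>y. of_real (2 * \<kappa>) * (of_real (a (y - x)) * f y)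
        + (if x = y then of_real (B x - 2 * \<kappa>) * f y else 0)) has_sum
      (of_real (2 * \<kappa>) * (generator a f x + f x) + of_real (B x - 2 * \<kappa>) * f x)) UNIV" .
  moreover have "of_real (2 * \<kappa>) * (generator a f x + f x) + of_real (B x - 2 * \<kappa>) * f x = H2 \<kappa> a B f x"
    by (simp add: H2_def algebra_simps)
  moreover have "(\<lambda>y. of_real (2 * \<kappa>) * (of_real (a (y - x)) * f y)
        + (if x = y then of_real (B x - 2 * \<kappa>) * f y else 0))
      = (\<lambda>y. of_real (schroedinger_kernel \<kappa> a B x y) * f y)"
    by (auto simp: schroedinger_kernel_def algebra_simps)
  ultimately show ?thesis
    by simp
qed

lemma correlation_sum_le:
  fixes b :: "int ^ 'd::finite \<Rightarrow> real"
  assumes b: "(\<lambda>z. \<bar>b z\<bar>) summable_on UNIV" and F: "finite F"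
  shows "(\<Sum>x\<in>F. \<bar>correlation b x\<bar>) \<le> (infsum (\<lambda>z. \<bar>b z\<bar>) UNIV)\<^sup>2"
proof -
  define M where "M = infsum (\<lambda>z. \<bar>b z\<bar>) UNIV"
  have M: "((\<lambda>z. \<bar>b z\<bar>) has_sum M) UNIV"
    unfolding M_def using b by simp
  have partial: "(\<Sum>x\<in>G. \<bar>b (x - z)\<bar>) \<le> M" if "finite G" for G z
    using that M has_sum_translate[of "\<lambda>z. \<bar>b z\<bar>" z M]
    by (intro finite_sum_le_has_sum[where A = UNIV]) auto
  have "((\<lambda>z. \<bar>b (- z)\<bar>) has_sum M) UNIV"
    using has_sum_reindex_bij_betw[OF bij_uminus, of "\<lambda>z. \<bar>b z\<bar>" M] M by simp
  then have M': "((\<lambda>z. M * \<bar>b (- z)\<bar>) has_sum M * M) UNIV"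
    by (rule has_sum_cmult_right)
  have summ: "(\<lambda>z. \<bar>b (x - z)\<bar> * \<bar>b (- z)\<bar>) summable_on UNIV" for x
    by (rule summable_on_comparison_test[OF has_sum_imp_summable[OF M']])
      (use partial[of "{x}"] in \<open>auto intro!: mult_right_mono\<close>)
  have "(\<Sum>x\<in>F. \<bar>correlation b x\<bar>) \<le> (\<Sum>x\<in>F. infsum (\<lambda>z. \<bar>b (x - z)\<bar> * \<bar>b (- z)\<bar>) UNIV)"
  proof (rule sum_mono)
    fix x
    have "norm (correlation b x) \<le> infsum (\<lambda>z. norm (b (x - z) * b (- z))) UNIV"
      unfolding correlation_def using summ[of x] by (intro norm_infsum_bound) (simp add: abs_mult)
    then show "\<bar>correlation b x\<bar> \<le> infsum (\<lambda>z. \<bar>b (x - z)\<bar> * \<bar>b (- z)\<bar>) UNIV"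
      by (simp add: abs_mult)
  qed
  also have "\<dots> \<le> M * M"
  proof (rule has_sum_mono)
    show "((\<lambda>z. \<Sum>x\<in>F. \<bar>b (x - z)\<bar> * \<bar>b (- z)\<bar>) has_sum
        (\<Sum>x\<in>F. infsum (\<lambda>z. \<bar>b (x - z)\<bar> * \<bar>b (- z)\<bar>) UNIV)) UNIV"
      by (intro has_sum_sum has_sum_infsum summ)
    show "(\<Sum>x\<in>F. \<bar>b (x - z)\<bar> * \<bar>b (- z)\<bar>) \<le> M * \<bar>b (- z)\<bar>" for z
      unfolding sum_distrib_right[symmetric] by (intro mult_right_mono partial F) auto
  qed (rule M')
  finally show ?thesis
    by (simp add: M_def power2_eq_square)
qed


lemma positive_eigenvalue_iff:
  fixes a B :: "int ^ 'd::finite \<Rightarrow> real"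
  assumes a: "(a has_sum 1) UNIV" "\<And>z. 0 \<le> a z" "\<And>z. a z = a (- z)"
    and B: "\<And>x. 0 \<le> B x" "\<And>F. finite F \<Longrightarrow> (\<Sum>x\<in>F. B x) \<le> M"
    and \<kappa>: "0 < \<kappa>"
  shows "(\<exists>\<mu>>0. eigenvalue (H2 \<kappa> a B) \<mu>)
    \<longleftrightarrow> (\<exists>S f. finite S \<and> 0 < quad_form (schroedinger_kernel \<kappa> a B) S f)"
proof
  let ?K = "schroedinger_kernel \<kappa> a B"
  have sym: "?K x y = ?K y x" for x y
    by (rule schroedinger_kernel_sym) (rule a(3))
  have B_le: "\<bar>B x\<bar> \<le> M" for x
    using B(1)[of x] B(2)[of "{x}"] by simp
  have rows: "(\<Sum>y\<in>F. \<bar>?K x y\<bar>) \<le> 4 * \<kappa> + M" if "finite F" for x F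
    by (rule schroedinger_kernel_row_sum_le[OF a(1,2) B_le \<kappa> that])
  {
    assume "\<exists>\<mu>>0. eigenvalue (H2 \<kappa> a B) \<mu>"
    then obtain \<mu> f where \<mu>: "0 < \<mu>" and f: "f \<in> l2" "\<And>x. H2 \<kappa> a B f x = of_real \<mu> * f x" "f \<noteq> 0"
      by (auto simp: eigenvalue_def eigenspace_def)
    obtain R where R: "\<And>x. cmod (f x) \<le> R"
      using l2_bounded[OF f(1)] by blast
    have eig: "((\<lambda>y. of_real (?K x y) * f y) has_sum of_real \<mu> * f x) UNIV" for x
      using H2_has_sum[where f = f, OF a(1,2) R, of \<kappa> B x] by (simp add: f(2))
    have part: "\<exists>S f. finite S \<and> 0 < quad_form ?K S f"
      if "\<exists>x. u x \<noteq> 0" "\<And>x. ((\<lambda>y. ?K x y * u y) has_sum (\<mu> * u x)) UNIV" "\<And>x. \<bar>u x\<bar> \<le> cmod (f x)" for u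
    proof -
      have "(\<lambda>x. (u x)\<^sup>2) summable_on UNIV"
        by (rule summable_on_comparison_test[of "\<lambda>x. (cmod (f x))\<^sup>2"])
          (use f(1) that(3) in \<open>auto simp: l2_def abs_le_square_iff[symmetric]\<close>)
      moreover have "0 < 4 * \<kappa> + M"
        using \<kappa> B_le[of 0] by linarith
      ultimately show ?thesis
        using truncated_eigenvector_positive[OF sym rows _ _ that(1) \<mu> that(2)] by blast
    qed
    obtain x where "f x \<noteq> 0"
      using f(3) by (auto simp: fun_eq_iff)
    then consider "Re (f x) \<noteq> 0" | "Im (f x) \<noteq> 0"
      by (auto simp: complex_eq_iff)
    then show "\<exists>S f. finite S \<and> 0 < quad_form ?K S f"
    proof cases
      case 1
      then show ?thesis
        using has_sum_Re[OF eig] abs_Re_le_cmod by (intro part[of "\<lambda>x. Re (f x)"]) auto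
    next
      case 2
      then show ?thesis
        using has_sum_Im[OF eig] abs_Im_le_cmod by (intro part[of "\<lambda>x. Im (f x)"]) auto
    qed
  }
  assume "\<exists>S f. finite S \<and> 0 < quad_form ?K S f"
  then obtain S0 f0 where pos: "finite S0" "0 < quad_form ?K S0 f0"
    by blast
  have summ: "(\<lambda>y. \<bar>?K x y\<bar>) summable_on UNIV" for x
    by (rule nonneg_bdd_above_summable_on) (auto intro!: bdd_aboveI2[where M = "4 * \<kappa> + M"] rows)
  have upper: "quad_form ?K S f \<le> (\<Sum>x\<in>S. B x * (f x)\<^sup>2)" if "finite S" for S f
    using dirichlet_form_nonneg[OF a(1,2) that, of f] \<kappa> by (simp add: quad_form_schroedinger[OF that])
  have level: "finite {x. \<delta> \<le> B x}" if "0 < \<delta>" for \<delta>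
  proof -
    have "card G \<le> nat \<lfloor>M / \<delta>\<rfloor>" if "G \<subseteq> {x. \<delta> \<le> B x}" "finite G" for G
    proof -
      have "real (card G) * \<delta> \<le> (\<Sum>x\<in>G. B x)"
        using sum_mono[of G "\<lambda>_. \<delta>" B] that by auto
      also have "\<dots> \<le> M"
        by (rule B(2)) fact
      finally have "real (card G) \<le> M / \<delta>"
        using \<open>0 < \<delta>\<close> by (simp add: pos_le_divide_eq)
      then show ?thesis
        by (simp add: le_nat_floor)
    qed
    then show ?thesis
      using finite_if_finite_subsets_card_bdd by blast
  qed
  obtain \<mu> u where \<mu>: "0 < \<mu>" and u: "\<exists>x. u x \<noteq> 0" "(\<lambda>x. (u x)\<^sup>2) summable_on UNIV"
    and eig: "\<And>x. ((\<lambda>y. ?K x y * u y) has_sum (\<mu> * u x)) UNIV"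
    using positive_eigenvector_exists[OF sym summ upper B(1) level pos] by auto
  define f :: "int ^ 'd \<Rightarrow> complex" where "f x = of_real (u x)" for x
  have f: "f \<in> l2"
    using u(2) by (simp add: l2_def f_def)
  then obtain R where R: "\<And>x. cmod (f x) \<le> R"
    using l2_bounded by blast
  have "H2 \<kappa> a B f x = of_real \<mu> * f x" for x
  proof (rule has_sum_unique[OF H2_has_sum[where f = f, OF a(1,2) R]])
    show "((\<lambda>y. of_real (?K x y) * f y) has_sum of_real \<mu> * f x) UNIV"
      using has_sum_of_real[OF eig[of x], where 'a = complex] by (simp add: f_def)
  qed
  moreover have "f \<noteq> 0"
    using u(1) by (auto simp: f_def fun_eq_iff)
  ultimately have "eigenvalue (H2 \<kappa> a B) \<mu>"
    using f by (auto simp: eigenvalue_def eigenspace_def)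
  then show "\<exists>\<mu>>0. eigenvalue (H2 \<kappa> a B) \<mu>"
    using \<mu> by blast
qed

section \<open>The critical coupling\<close>

theorem theorem9p5:
  fixes a b B :: "int ^ 'd::finite \<Rightarrow> real"
  assumes B_def: "B = correlation b"
    and a_nonneg: "\<And>z. 0 \<le> a z"
    and a_sym: "\<And>z. a z = a (- z)"
    and a_zero: "a 0 = 0"
    and a_unit: "\<And>z. lattice_norm z = 1 \<Longrightarrow> 0 < a z"
    and a_sum: "(a has_sum 1) UNIV"
    and b_sum: "(\<lambda>z. \<bar>b z\<bar>) summable_on UNIV"
    and B_zero: "0 < B 0"
    and dim: "3 \<le> CARD('d)"
    and a_moment: "(\<lambda>z. (lattice_norm z)\<^sup>2 * a z) summable_on UNIV"
    and B_sum: "(\<lambda>x. \<bar>B x\<bar> powr (real CARD('d) / 2)) summable_on UNIV"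
    and B_nonneg: "\<And>x. 0 \<le> B x"
  shows "\<exists>\<kappa>cr>0. \<forall>\<kappa>>0.
    (\<kappa> > \<kappa>cr \<longrightarrow> num_pos_eigenvalues (H2 \<kappa> a B) = 0) \<and>
    (\<kappa> < \<kappa>cr \<longrightarrow> 1 \<le> num_pos_eigenvalues (H2 \<kappa> a B))"
proof -
  define M where "M = (infsum (\<lambda>z. \<bar>b z\<bar>) UNIV)\<^sup>2"
  have B_le: "(\<Sum>x\<in>F. B x) \<le> M" if "finite F" for F
    using correlation_sum_le[OF b_sum that] B_nonneg by (simp add: B_def M_def)
  obtain C where C: "0 < C" "\<And>S f x. finite S \<Longrightarrow> (\<And>x. x \<notin> S \<Longrightarrow> f x = 0) \<Longrightarrow>
      (f x)\<^sup>2 \<le> C * dirichlet_form a S f"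
    using lattice_transience[OF a_sum a_nonneg a_unit dim] by metis
  define P where "P = {\<kappa>. 0 < \<kappa> \<and> (\<exists>S f. finite S \<and> 0 < quad_form (schroedinger_kernel \<kappa> a B) S f)}"
  have eig_iff: "(\<exists>\<mu>>0. eigenvalue (H2 \<kappa> a B) \<mu>) \<longleftrightarrow> \<kappa> \<in> P" if "0 < \<kappa>" for \<kappa>
    using positive_eigenvalue_iff[OF a_sum a_nonneg a_sym B_nonneg B_le that] that by (simp add: P_def)
  have P_le: "\<kappa> \<le> M * C / 2" if "\<kappa> \<in> P" for \<kappa>
  proof -
    obtain S f0 where S: "finite S" "0 < quad_form (schroedinger_kernel \<kappa> a B) S f0"
      using \<open>\<kappa> \<in> P\<close> by (auto simp: P_def)
    define f where "f x = (if x \<in> S then f0 x else 0)" for x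
    define E where "E = dirichlet_form a S f"
    have "0 < quad_form (schroedinger_kernel \<kappa> a B) S f"
      using S(2) by (simp add: quad_form_def f_def)
    also have "\<dots> = (\<Sum>x\<in>S. B x * (f x)\<^sup>2) - 2 * \<kappa> * E"
      unfolding E_def by (rule quad_form_schroedinger[OF S(1)])
    also have "(\<Sum>x\<in>S. B x * (f x)\<^sup>2) \<le> (\<Sum>x\<in>S. B x * (C * E))"
      unfolding E_def by (intro sum_mono mult_left_mono C B_nonneg S) (simp add: f_def)
    also have "\<dots> = (\<Sum>x\<in>S. B x) * (C * E)"
      by (simp add: sum_distrib_right)
    also have "\<dots> \<le> M * (C * E)"
      using dirichlet_form_nonneg[OF a_sum a_nonneg S(1)] C(1)
      by (intro mult_right_mono B_le S) (simp add: E_def)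
    finally have "0 < (M * C - 2 * \<kappa>) * E"
      by (simp add: algebra_simps)
    moreover have "0 \<le> E"
      unfolding E_def by (rule dirichlet_form_nonneg[OF a_sum a_nonneg S(1)])
    ultimately show ?thesis
      by (simp add: zero_less_mult_iff)
  qed
  have P_down: "\<kappa>' \<in> P" if "\<kappa> \<in> P" "0 < \<kappa>'" "\<kappa>' \<le> \<kappa>" for \<kappa> \<kappa>'
  proof -
    obtain S f where S: "finite S" "0 < quad_form (schroedinger_kernel \<kappa> a B) S f"
      using \<open>\<kappa> \<in> P\<close> by (auto simp: P_def)
    have "\<kappa>' * dirichlet_form a S f \<le> \<kappa> * dirichlet_form a S f"
      by (intro mult_right_mono that dirichlet_form_nonneg a_sum a_nonneg S)
    then have "0 < quad_form (schroedinger_kernel \<kappa>' a B) S f"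
      using S by (simp add: quad_form_schroedinger)
    then show ?thesis
      using S(1) that(2) by (auto simp: P_def)
  qed
  have P_mem: "B 0 / 4 \<in> P"
  proof -
    have "0 < quad_form (schroedinger_kernel (B 0 / 4) a B) {0} (\<lambda>_. 1)"
      using B_zero by (simp add: quad_form_def schroedinger_kernel_def a_zero)
    moreover have "finite {0 :: int ^ 'd}"
      by simp
    ultimately have "\<exists>S f. finite S \<and> 0 < quad_form (schroedinger_kernel (B 0 / 4) a B) S f"
      by blast
    then show ?thesis
      using B_zero by (simp add: P_def)
  qed
  have bdd: "bdd_above P"
    using P_le by (rule bdd_aboveI)
  show ?thesis
  proof (intro exI[of _ "Sup P"] conjI allI impI)
    show "0 < Sup P"
      using cSup_upper[OF P_mem bdd] B_zero by linarith
  next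
    fix \<kappa> :: real assume \<kappa>: "0 < \<kappa>" "Sup P < \<kappa>"
    then have "\<kappa> \<notin> P"
      using cSup_upper[OF _ bdd, of \<kappa>] by force
    then show "num_pos_eigenvalues (H2 \<kappa> a B) = 0"
      using eig_iff[OF \<kappa>(1)] by (intro num_pos_eigenvalues_eq_0) auto
  next
    fix \<kappa> :: real assume \<kappa>: "0 < \<kappa>" "\<kappa> < Sup P"
    then obtain \<kappa>' where "\<kappa>' \<in> P" "\<kappa> < \<kappa>'"
      using less_cSup_iff[OF _ bdd] P_mem by blast
    then have "\<kappa> \<in> P"
      using P_down \<kappa>(1) by simp
    then show "1 \<le> num_pos_eigenvalues (H2 \<kappa> a B)"
      using eig_iff[OF \<kappa>(1)] num_pos_eigenvalues_ge_1 by blast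
  qed
qed

end
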